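(* Let $\mu$ be a finitely additive real-valued probability measure defined on an algebra $\mathcal A$ of subsets of a set $X$, giving measure zero to all singletons. Then there is a filter $F_\mu$ over $[X]^{<\omega}$, definable from $\mu$, which is the smallest (with respect to inclusion) fine filter $F$ over $[X]^{<\omega}$ with the property that for every bounded $\mu$-measurable function $f : X \to \mathbb R$, $$\int f \, d\mu = \mathrm{st}\!\int f \, dF$$ (in particular the standard integral on the right-hand side exists).
   Context: $[X]^{<\omega}$ is the set of finite subsets of $X$. Filters are proper. A filter $F$ over $[X]^{<\omega}$ is fine if $\{z\in[X]^{<\omega} : x\in z\}\in F$ for every $x\in X$. For a filter $F$ over a set $Z$, $\mathrm{Pow}(\mathbb R,F)$ is the set of functions $Z\to\mathbb R$ modulo the relation of agreeing on a set in $F$; the class of $g$ is $[g]_F$. Ring operations are computed pointwise, and $[g]_F<[h]_F$ iff $\{z: g(z)<h(z)\}\in F$. $\mathbb R$ is embedded via constant functions. For a fine filter $F$ over $[X]^{<\omega}$ and $f:X\to\mathbb R$, the filter integral is $\int f\,dF=\left[z\mapsto \frac1{|z|}\sum_{x\in z}f(x)\right]_F\in \mathrm{Pow}(\mathbb R,F)$. For $a\in\mathrm{Pow}(\mathbb R,F)$ put $\mathrm{st}^+a=\inf\{q\in\mathbb Q: a<q\}$ and $\mathrm{st}^-a=\sup\{q\in\mathbb Q: q<a\}$ (with $\inf\emptyset=\sup\mathbb Q=\infty$, $\sup\emptyset=\inf\mathbb Q=-\infty$). If these are equal, $a$ has a standard part $\mathrm{st}\,a$, their common value. The standard integral is $\mathrm{st}\!\int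 f\,dF:=\mathrm{st}(\int f\,dF)$, when defined. A bounded $f:X\to\mathbb R$ is $\mu$-measurable if $\{x: a<f(x)\le b\}\in\mathcal A$ for all reals $a<b$. Its integral $\int f\,d\mu$ with respect to the finitely additive $\mu$ is the common limit of the integrals of lower and upper simple approximations $\sum_i \frac{Mi}{n}\mu(\{\frac{Mi}{n}<f\le \frac{M(i+1)}{n}\})$ and $\sum_i \frac{M(i+1)}{n}\mu(\{\frac{Mi}{n}<f\le \frac{M(i+1)}{n}\})$, $-n\le i<n$, as $n\to\infty$, where $|f|<M$. "Definable from $\mu$" means definable by a formula of set theory with parameter $\mu$. *)

theory Defs
  imports "HOL-Analysis.Analysis"
begin

definition fa_probability :: "'a set \<Rightarrow> 'a set set \<Rightarrow> ('a set \<Rightarrow> real) \<Rightarrow> bool" where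
  "fa_probability X \<A> \<mu> \<longleftrightarrow>
     algebra X \<A> \<and> (\<forall>S\<in>\<A>. 0 \<le> \<mu> S) \<and> \<mu> {} = 0 \<and> \<mu> X = 1 \<and> Measure_Space.additive \<A> \<mu>"

definition fa_measurable :: "'a set \<Rightarrow> 'a set set \<Rightarrow> ('a \<Rightarrow> real) \<Rightarrow> bool" where
  "fa_measurable X \<A> f \<longleftrightarrow> (\<forall>a b. a < b \<longrightarrow> {x \<in> X. a < f x \<and> f x \<le> b} \<in> \<A>)"

definition fa_slice :: "'a set \<Rightarrow> ('a \<Rightarrow> real) \<Rightarrow> real \<Rightarrow> nat \<Rightarrow> int \<Rightarrow> 'a set" where
  "fa_slice X f M n i =
     {x \<in> X. M * of_int i / of_nat n < f x \<and> f x \<le> M * of_int (i + 1) / of_nat n}"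

definition fa_lower :: "'a set \<Rightarrow> ('a set \<Rightarrow> real) \<Rightarrow> ('a \<Rightarrow> real) \<Rightarrow> real \<Rightarrow> nat \<Rightarrow> real" where
  "fa_lower X \<mu> f M n =
     (\<Sum>i\<in>{- int n..<int n}. M * of_int i / of_nat n * \<mu> (fa_slice X f M n i))"

definition fa_upper :: "'a set \<Rightarrow> ('a set \<Rightarrow> real) \<Rightarrow> ('a \<Rightarrow> real) \<Rightarrow> real \<Rightarrow> nat \<Rightarrow> real" where
  "fa_upper X \<mu> f M n =
     (\<Sum>i\<in>{- int n..<int n}. M * of_int (i + 1) / of_nat n * \<mu> (fa_slice X f M n i))"

text \<open>The limit does not depend on the bound \<open>M\<close>, so every admissible \<open>M\<close> is required to give it.\<close>

definition has_fa_integral :: "'a set \<Rightarrow> ('a set \<Rightarrow> real) \<Rightarrow> ('a \<Rightarrow> real) \<Rightarrow> real \<Rightarrow> bool" where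
  "has_fa_integral X \<mu> f I \<longleftrightarrow>
     (\<forall>M. (\<forall>x\<in>X. \<bar>f x\<bar> < M) \<longrightarrow>
        fa_lower X \<mu> f M \<longlonglongrightarrow> I \<and> fa_upper X \<mu> f M \<longlonglongrightarrow> I)"

definition fa_integral :: "'a set \<Rightarrow> ('a set \<Rightarrow> real) \<Rightarrow> ('a \<Rightarrow> real) \<Rightarrow> real" where
  "fa_integral X \<mu> f = (THE I. has_fa_integral X \<mu> f I)"

text \<open>A proper filter over the set \<open>Fpow X\<close> is represented by a library filter on the type
  \<open>'a set\<close> that is not \<open>bot\<close> and contains \<open>Fpow X\<close>; \<open>filter_family\<close> recovers it as a
  family of subsets of \<open>Fpow X\<close>. (Inclusion of families is the reverse of the order \<open>\<le>\<close> on
  library filters.)\<close>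

definition filter_family :: "'a set \<Rightarrow> 'a set filter \<Rightarrow> 'a set set set" where
  "filter_family X F = {W. W \<subseteq> Fpow X \<and> eventually (\<lambda>z. z \<in> W) F}"

definition fine_filter :: "'a set \<Rightarrow> 'a set filter \<Rightarrow> bool" where
  "fine_filter X F \<longleftrightarrow>
     F \<noteq> bot \<and> eventually (\<lambda>z. z \<in> Fpow X) F \<and> (\<forall>x\<in>X. eventually (\<lambda>z. x \<in> z) F)"

text \<open>Elements of the reduced power of the reals are equivalence classes of functions. As \<open>F\<close>
  contains \<open>Fpow X\<close>, values of the representatives outside \<open>Fpow X\<close> are irrelevant.\<close>

definition reduced_rel :: "'z filter \<Rightarrow> (('z \<Rightarrow> real) \<times> ('z \<Rightarrow> real)) set" where
  "reduced_rel F = {(g, h). eventually (\<lambda>z. g z = h z) F}"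

definition reduced_class :: "'z filter \<Rightarrow> ('z \<Rightarrow> real) \<Rightarrow> ('z \<Rightarrow> real) set" where
  "reduced_class F g = reduced_rel F `` {g}"

definition reduced_less ::
    "'z filter \<Rightarrow> ('z \<Rightarrow> real) set \<Rightarrow> ('z \<Rightarrow> real) set \<Rightarrow> bool" where
  "reduced_less F a b \<longleftrightarrow> (\<exists>g\<in>a. \<exists>h\<in>b. eventually (\<lambda>z. g z < h z) F)"

definition reduced_const :: "'z filter \<Rightarrow> real \<Rightarrow> ('z \<Rightarrow> real) set" where
  "reduced_const F r = reduced_class F (\<lambda>_. r)"

definition filter_integral :: "('a \<Rightarrow> real) \<Rightarrow> 'a set filter \<Rightarrow> ('a set \<Rightarrow> real) set" where
  "filter_integral f F = reduced_class F (\<lambda>z. (\<Sum>x\<in>z. f x) / of_nat (card z))"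

definition st_plus :: "'z filter \<Rightarrow> ('z \<Rightarrow> real) set \<Rightarrow> ereal" where
  "st_plus F a = Inf {ereal (of_rat q) | q. reduced_less F a (reduced_const F (of_rat q))}"

definition st_minus :: "'z filter \<Rightarrow> ('z \<Rightarrow> real) set \<Rightarrow> ereal" where
  "st_minus F a = Sup {ereal (of_rat q) | q. reduced_less F (reduced_const F (of_rat q)) a}"

definition has_st :: "'z filter \<Rightarrow> ('z \<Rightarrow> real) set \<Rightarrow> ereal \<Rightarrow> bool" where
  "has_st F a s \<longleftrightarrow> st_plus F a = s \<and> st_minus F a = s"

definition integrates ::
    "'a set \<Rightarrow> 'a set set \<Rightarrow> ('a set \<Rightarrow> real) \<Rightarrow> 'a set filter \<Rightarrow> bool" where
  "integrates X \<A> \<mu> F \<longleftrightarrow>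
     (\<forall>f. bounded (f ` X) \<and> fa_measurable X \<A> f \<longrightarrow>
        has_st F (filter_integral f F) (ereal (fa_integral X \<mu> f)))"

text \<open>A type \<open>'b\<close> of atoms yields the cumulative hierarchy \<open>V\<^sub>0 = 'b\<close>,
  \<open>V\<^sub>k\<^sub>+\<^sub>1 = 'b \<union> Pow V\<^sub>k\<close>, where \<open>V\<^sub>k\<close> sits inside \<open>V\<^sub>k\<^sub>+\<^sub>1\<close>; rank 4 is the rank of the graph
  of a set function such as \<open>\<mu>\<close> when points and reals are atoms.\<close>

datatype ('b, 'c) node = Atom 'b | Coll "'c set"

type_synonym 'b V3 = "('b, ('b, ('b, 'b) node) node) node"
type_synonym 'b V4 = "('b, 'b V3) node"

primrec lift_node :: "('c \<Rightarrow> 'd) \<Rightarrow> ('b, 'c) node \<Rightarrow> ('b, 'd) node" where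
  "lift_node h (Atom b) = Atom b"
| "lift_node h (Coll S) = Coll (h ` S)"

definition incl :: "'b V3 \<Rightarrow> 'b V4" where
  "incl = lift_node (lift_node (lift_node Atom))"

primrec members :: "'b V4 \<Rightarrow> 'b V4 set" where
  "members (Atom b) = {}"
| "members (Coll S) = incl ` S"

definition next_level :: "'b set \<Rightarrow> 'c set \<Rightarrow> ('b, 'c) node set" where
  "next_level B D = Atom ` B \<union> Coll ` Pow D"

text \<open>The atoms are the points of \<open>X\<close> and the real numbers only; other inhabitants of the type
  \<open>'a\<close> must not be accessible to formulas.\<close>

definition universe :: "'a set \<Rightarrow> ('a + real) V4 set" where
  "universe X =
     (let B = Inl ` X \<union> range Inr
      in next_level B (next_level B (next_level B (next_level B B))))"

text \<open>First-order formulas with named variables. Besides membership and equality there are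
  predicates for the order and the field operations of the reals, because reals are atoms here;
  these are definable without parameters in set theory.\<close>

datatype fm =
    Mem nat nat
  | Eq nat nat
  | Less nat nat
  | Plus nat nat nat
  | Times nat nat nat
  | Neg fm
  | Conj fm fm
  | All nat fm

primrec sat :: "('a + real) V4 set \<Rightarrow> (nat \<Rightarrow> ('a + real) V4) \<Rightarrow> fm \<Rightarrow> bool" where
  "sat U e (Mem i j) \<longleftrightarrow> e i \<in> members (e j)"
| "sat U e (Eq i j) \<longleftrightarrow> e i = e j"
| "sat U e (Less i j) \<longleftrightarrow>
     (\<exists>r s. e i = Atom (Inr r) \<and> e j = Atom (Inr s) \<and> r < s)"
| "sat U e (Plus i j k) \<longleftrightarrow>
     (\<exists>r s. e i = Atom (Inr r) \<and> e j = Atom (Inr s) \<and> e k = Atom (Inr (r + s)))"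
| "sat U e (Times i j k) \<longleftrightarrow>
     (\<exists>r s. e i = Atom (Inr r) \<and> e j = Atom (Inr s) \<and> e k = Atom (Inr (r * s)))"
| "sat U e (Neg p) \<longleftrightarrow> \<not> sat U e p"
| "sat U e (Conj p q) \<longleftrightarrow> sat U e p \<and> sat U e q"
| "sat U e (All i p) \<longleftrightarrow> (\<forall>u\<in>U. sat U (e(i := u)) p)"

text \<open>Variable 0 stands for the object defined and variable 1 for the parameter. The
  quantification over all assignments \<open>e\<close> prevents other variables from acting as parameters.
  Satisfaction in a set-sized structure is itself expressible in set theory, and the structure
  \<open>universe X\<close> depends on \<open>X\<close> only, the largest element of the domain of \<open>\<mu>\<close>. So
  definability in this sense implies definability from \<open>\<mu>\<close> by a formula interpreted in the
  whole set-theoretic universe.\<close>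

definition definable_from ::
    "('a + real) V4 set \<Rightarrow> ('a + real) V4 \<Rightarrow> ('a + real) V4 \<Rightarrow> bool" where
  "definable_from U p y \<longleftrightarrow>
     p \<in> U \<and> y \<in> U \<and>
     (\<exists>\<phi>. \<forall>e. range e \<subseteq> U \<and> e 1 = p \<longrightarrow> (sat U e \<phi> \<longleftrightarrow> e 0 = y))"

definition kpair :: "('b, 'c) node \<Rightarrow> ('b, 'c) node \<Rightarrow> ('b, ('b, ('b, 'c) node) node) node" where
  "kpair u v = Coll {Coll {u}, Coll {u, v}}"

text \<open>The graph of \<open>\<mu>\<close> on \<open>\<A>\<close>, as a set of Kuratowski pairs. It determines \<open>\<A>\<close> and \<open>X\<close>.\<close>

definition code_measure :: "'a set set \<Rightarrow> ('a set \<Rightarrow> real) \<Rightarrow> ('a + real) V4" where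
  "code_measure \<A> \<mu> = Coll ((\<lambda>S. kpair (Coll (Inl ` S)) (Atom (Inr (\<mu> S)))) ` \<A>)"

text \<open>A family of sets of sets of points; points are embedded as atoms of the level dictated
  by the type.\<close>

definition code_family :: "'a set set set \<Rightarrow> ('a + real) V4" where
  "code_family \<F> = Coll ((\<lambda>W. Coll ((\<lambda>z. Coll ((\<lambda>x. Atom (Inl x)) ` z)) ` W)) ` \<F>)"

end

theory Submission
  imports Defs
begin

text \<open>
The filter is generated by the sets \<open>{z. x \<in> z}\<close>, one for each point
\<open>x\<close>, and by the sets \<open>{z. \<Sum>x\<in>z. g x > 0}\<close>, one for each
two-valued function \<open>g\<close> (value \<open>d\<close> on some \<open>S \<in> \<A>\<close>,
value \<open>a\<close> off \<open>S\<close>) whose integral \<open>(d - a) \<mu> S + a\<close> is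
positive.

Every fine filter \<open>F\<close> that computes the integral contains these sets, because a
positive standard part of \<open>\<integral> g dF\<close> forces the averages of \<open>g\<close>
to be positive on a set in \<open>F\<close> (\<open>le_fa_filter\<close>). Hence minimality is
automatic, and three things remain.

The filter is proper (\<open>fa_filter_proper\<close>). Finitely many members \<open>S\<close> of
\<open>\<A>\<close> cut \<open>X\<close> into finitely many cells of \<open>\<A>\<close>. Finite
sets are null, so a cell of positive measure is infinite, and one can choose about \<open>N \<mu>
B\<close> points in each cell \<open>B\<close>. As \<open>N\<close> grows, the proportions of
these samples converge to the values of \<open>\<mu>\<close>, and the finitely many prescribed
points added to each sample do not change the limit (\<open>proportional_samples\<close>).

The filter computes integrals (\<open>average_tendsto_fa_integral\<close>). Taking
\<open>g\<close> with values \<open>b - 1\<close> and \<open>b\<close>, or \<open>1 - b\<close>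
and \<open>- b\<close>, shows that the frequency \<open>|z \<inter> S| / |z|\<close> converges to
\<open>\<mu> S\<close> along the filter. A bounded measurable function is within \<open>M /
n\<close> of its simple approximations, so its average is eventually within \<open>2 M / n\<close>
of the lower and upper sums. Since the filter is proper, these bounds also make the lower sums a
Cauchy sequence: the averages along the filter yield existence of the integral.

The filter is definable from \<open>\<mu>\<close> (\<open>definable_filter_family\<close>). It is
the least family of sets of finite sets that contains the generators and is closed under
intersections and supersets. Finiteness and the sums over finite sets are in turn described by a
least fixed point: the relation between a finite set and its sum is the least relation that
contains \<open>(\<emptyset>, 0)\<close> and is closed under adding one point. Such relations have
the same rank as the graph of \<open>\<mu>\<close>, so all the quantifiers involved range over
\<open>universe X\<close>.
\<close>

section \<open>Finitely additive probabilities and the generated filter\<close>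

text \<open>
Positivity of a sum, rather than a bound on \<open>|z \<inter> S| / |z|\<close>, keeps divisions
and cardinalities out of the generators; this makes them easy to describe by first-order formulas.
\<close>

definition generators :: "'a set \<Rightarrow> 'a set set \<Rightarrow> ('a set \<Rightarrow> real) \<Rightarrow> 'a set set set" where
  "generators X \<A> \<mu> =
     {{z \<in> Fpow X. x \<in> z} | x. x \<in> X} \<union>
     {{z \<in> Fpow X. 0 < (\<Sum>x\<in>z. if x \<in> S then d else a)} | S d a.
        S \<in> \<A> \<and> 0 < (d - a) * \<mu> S + a}"

definition fa_filter :: "'a set \<Rightarrow> 'a set set \<Rightarrow> ('a set \<Rightarrow> real) \<Rightarrow> 'a set filter" where
  "fa_filter X \<A> \<mu> = (INF G\<in>generators X \<A> \<mu>. principal G)"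

lemma step_sum:
  fixes d a :: real
  assumes "finite z"
  shows "(\<Sum>x\<in>z. if x \<in> S then d else a) = (d - a) * real (card (z \<inter> S)) + a * real (card z)"
proof -
  have "(\<Sum>x\<in>z. if x \<in> S then d else a) = (\<Sum>x\<in>z \<inter> S. d) + (\<Sum>x\<in>z \<inter> - S. a)"
    using assms by (simp add: sum.If_cases Int_def)
  moreover have "card z = card (z \<inter> S) + card (z \<inter> - S)"
    using assms by (metis Diff_eq card_Int_Diff)
  ultimately show ?thesis by (simp add: algebra_simps)
qed

locale fa_space =
  fixes X :: "'a set" and \<A> :: "'a set set" and \<mu> :: "'a set \<Rightarrow> real"
  assumes fa_probability: "fa_probability X \<A> \<mu>"

sublocale fa_space \<subseteq> algebra X \<A>
  using fa_probability by (simp add: fa_probability_def)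

context fa_space
begin

abbreviation (input) "F \<equiv> fa_filter X \<A> \<mu>"

lemma measure_empty: "\<mu> {} = 0"
  and additive_measure: "Measure_Space.additive \<A> \<mu>"
  and measure_nonneg: "S \<in> \<A> \<Longrightarrow> 0 \<le> \<mu> S"
  and measure_space: "\<mu> X = 1"
  using fa_probability by (auto simp: fa_probability_def)

lemma space_nonempty: "X \<noteq> {}"
  using fa_probability by (auto simp: fa_probability_def)

lemma measure_disjoint_UN:
  "finite J \<Longrightarrow> B ` J \<subseteq> \<A> \<Longrightarrow> disjoint_family_on B J \<Longrightarrow> \<mu> (\<Union>i\<in>J. B i) = (\<Sum>i\<in>J. \<mu> (B i))"
proof (induction rule: finite_induct)
  case (insert i J)
  have "\<mu> (B i \<union> (\<Union>i\<in>J. B i)) = \<mu> (B i) + \<mu> (\<Union>i\<in>J. B i)"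
    using insert by (intro additiveD[OF additive_measure] finite_UN)
      (auto simp: disjoint_family_on_insert)
  moreover have "disjoint_family_on B J"
    using insert.prems(2) by (rule disjoint_family_on_mono[rotated]) auto
  ultimately show ?case using insert by simp
qed (simp add: measure_empty)

lemma eventually_generator: "G \<in> generators X \<A> \<mu> \<Longrightarrow> \<forall>\<^sub>F z in F. z \<in> G"
  unfolding fa_filter_def le_principal[symmetric] by (rule INF_lower)

lemma eventually_member: "x \<in> X \<Longrightarrow> \<forall>\<^sub>F z in F. z \<in> Fpow X \<and> x \<in> z"
  using eventually_generator[of "{z \<in> Fpow X. x \<in> z}"] by (auto simp: generators_def)

lemma eventually_nonempty: "\<forall>\<^sub>F z in F. z \<in> Fpow X \<and> z \<noteq> {}"
proof -
  obtain x where "x \<in> X" using space_nonempty by blast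
  from eventually_member[OF this] show ?thesis by eventually_elim blast
qed

lemma eventually_step_sum_pos:
  assumes "S \<in> \<A>" "0 < (d - a) * \<mu> S + a"
  shows "\<forall>\<^sub>F z in F. 0 < (d - a) * real (card (z \<inter> S)) + a * real (card z)"
proof -
  have "{z \<in> Fpow X. 0 < (\<Sum>x\<in>z. if x \<in> S then d else a)} \<in> generators X \<A> \<mu>"
    using assms by (auto simp: generators_def)
  from eventually_generator[OF this] show ?thesis
    by eventually_elim (auto simp: Fpow_def step_sum)
qed

text \<open>
The two-valued functions \<open>b - 1_S\<close> and \<open>1_S - b\<close> have integrals \<open>b
- \<mu> S\<close> and \<open>\<mu> S - b\<close>. So any \<open>b > \<mu> S\<close> is an eventual
upper bound and any \<open>b < \<mu> S\<close> an eventual lower bound of the frequency of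
\<open>S\<close>.
\<close>

lemma frequency_tendsto:
  assumes S: "S \<in> \<A>"
  shows "((\<lambda>z. real (card (z \<inter> S)) / real (card z)) \<longlongrightarrow> \<mu> S) F"
proof (rule order_tendstoI)
  fix b assume "b < \<mu> S"
  then have "\<forall>\<^sub>F z in F. 0 < ((1 - b) - (- b)) * real (card (z \<inter> S)) + (- b) * real (card z)"
    by (intro eventually_step_sum_pos[OF S]) simp
  with eventually_nonempty show "\<forall>\<^sub>F z in F. b < real (card (z \<inter> S)) / real (card z)"
  proof eventually_elim
    case (elim z)
    then have "0 < real (card z)" by (auto simp: Fpow_def card_gt_0_iff)
    then show ?case using elim(2) by (simp add: less_divide_eq)
  qed
next
  fix b assume "\<mu> S < b"
  then have "\<forall>\<^sub>F z in F. 0 < ((b - 1) - b) * real (card (z \<inter> S)) + b * real (card z)"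
    by (intro eventually_step_sum_pos[OF S]) simp
  with eventually_nonempty show "\<forall>\<^sub>F z in F. real (card (z \<inter> S)) / real (card z) < b"
  proof eventually_elim
    case (elim z)
    then have "0 < real (card z)" by (auto simp: Fpow_def card_gt_0_iff)
    then show ?case using elim(2) by (simp add: divide_less_eq)
  qed
qed

text \<open>
The points with a prescribed membership pattern \<open>T\<close> form one cell of the partition of
\<open>X\<close> induced by the members of \<open>\<S>\<close>.
\<close>

lemma fibre_in_sets:
  assumes "finite \<S>" "\<S> \<subseteq> \<A>"
  shows "{x \<in> X. \<forall>S\<in>\<S>. x \<in> S \<longleftrightarrow> S \<in> T} \<in> \<A>"
  using assms
proof (induction rule: finite_induct)
  case (insert S \<S>)
  have "{x \<in> X. \<forall>S\<in>insert S \<S>. x \<in> S \<longleftrightarrow> S \<in> T} =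
      (if S \<in> T then S else X - S) \<inter> {x \<in> X. \<forall>S\<in>\<S>. x \<in> S \<longleftrightarrow> S \<in> T}"
    using insert.prems sets_into_space by auto
  then show ?case using insert by (auto intro!: Int compl_sets)
qed simp

end

section \<open>Properness of the filter\<close>

lemma floor_fraction_tendsto:
  fixes c :: real
  assumes "0 \<le> c"
  shows "(\<lambda>N. real (nat \<lfloor>real N * c\<rfloor>) / real N) \<longlonglongrightarrow> c"
proof (rule tendsto_sandwich)
  show "(\<lambda>N. c - 1 / real N) \<longlonglongrightarrow> c"
    using tendsto_diff[OF tendsto_const lim_1_over_n, of c] by simp
  show "(\<lambda>N. c) \<longlonglongrightarrow> c" by simp
  have nat: "real (nat \<lfloor>real N * c\<rfloor>) = of_int \<lfloor>real N * c\<rfloor>" for N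
    using assms by (simp add: of_nat_nat)
  show "\<forall>\<^sub>F N in sequentially. c - 1 / real N \<le> real (nat \<lfloor>real N * c\<rfloor>) / real N"
    using eventually_gt_at_top[of 0]
  proof eventually_elim
    case (elim N)
    have "real N * c - 1 \<le> of_int \<lfloor>real N * c\<rfloor>" by linarith
    then have "(real N * c - 1) / real N \<le> of_int \<lfloor>real N * c\<rfloor> / real N"
      by (rule divide_right_mono) simp
    then show ?case unfolding nat using elim by (simp add: diff_divide_distrib)
  qed
  show "\<forall>\<^sub>F N in sequentially. real (nat \<lfloor>real N * c\<rfloor>) / real N \<le> c"
    using eventually_gt_at_top[of 0]
  proof eventually_elim
    case (elim N)
    have "of_int \<lfloor>real N * c\<rfloor> \<le> real N * c" by linarith
    then have "of_int \<lfloor>real N * c\<rfloor> / real N \<le> real N * c / real N"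
      by (rule divide_right_mono) simp
    then show ?case unfolding nat using elim by simp
  qed
qed

locale diffuse_fa_space = fa_space +
  assumes singletons_null: "\<forall>x\<in>X. {x} \<in> \<A> \<and> \<mu> {x} = 0"
begin

lemma measure_finite_set:
  "finite S \<Longrightarrow> S \<subseteq> X \<Longrightarrow> S \<in> \<A> \<and> \<mu> S = 0"
proof (induction rule: finite_induct)
  case empty
  then show ?case by (simp add: measure_empty)
next
  case (insert x S)
  have "\<mu> ({x} \<union> S) = \<mu> {x} + \<mu> S"
    using insert singletons_null by (intro additiveD[OF additive_measure]) auto
  moreover have "{x} \<union> S \<in> \<A>" using insert singletons_null by (intro Un) auto
  ultimately show ?case using insert singletons_null by simp
qed

text \<open>
The sample \<open>z N\<close> takes \<open>\<lfloor>N \<mu> B\<rfloor>\<close> points from each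
cell \<open>B\<close>. A finite cell is null and receives no points; an infinite one has enough
points outside \<open>Y\<close>.
\<close>

lemma proportional_samples:
  assumes \<S>: "finite \<S>" "\<S> \<subseteq> \<A>" and Y: "finite Y" "Y \<subseteq> X"
  obtains z where "\<And>N. z N \<in> Fpow X" "\<And>N. Y \<subseteq> z N"
    "\<And>S. S \<in> \<S> \<Longrightarrow> (\<lambda>N. real (card (z N \<inter> S)) / real N) \<longlonglongrightarrow> \<mu> S"
proof -
  define B where "B T = {x \<in> X. \<forall>S\<in>\<S>. x \<in> S \<longleftrightarrow> S \<in> T}" for T
  define k where "k T N = nat \<lfloor>real N * \<mu> (B T)\<rfloor>" for T N
  have B: "B T \<in> \<A>" for T using fibre_in_sets[OF \<S>] by (simp add: B_def)
  have disj: "disjoint_family_on B (Pow \<S>)"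
  proof (unfold disjoint_family_on_def, intro ballI impI)
    fix T T' assume *: "T \<in> Pow \<S>" "T' \<in> Pow \<S>" "T \<noteq> T'"
    then obtain S where "S \<in> \<S>" "S \<in> T \<longleftrightarrow> S \<notin> T'" by blast
    then show "B T \<inter> B T' = {}" by (auto simp: B_def)
  qed
  have "\<exists>C. finite C \<and> card C = k T N \<and> C \<subseteq> B T - Y" for T N
  proof (cases "finite (B T)")
    case True
    then have "\<mu> (B T) = 0" using measure_finite_set by (auto simp: B_def)
    then show ?thesis by (intro exI[of _ "{}"]) (simp add: k_def)
  next
    case False
    then have "infinite (B T - Y)" using Y by simp
    then show ?thesis by (rule infinite_arbitrarily_large)
  qed
  then obtain C where C: "\<And>T N. finite (C T N)" "\<And>T N. card (C T N) = k T N"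
    "\<And>T N. C T N \<subseteq> B T - Y" by metis
  define z where "z N = Y \<union> (\<Union>T\<in>Pow \<S>. C T N)" for N
  show thesis
  proof (rule that)
    show "z N \<in> Fpow X" for N
    proof -
      have "C T N \<subseteq> X" for T using C(3)[of T N] by (auto simp: B_def)
      then show ?thesis using C(1) Y \<S>(1) by (simp add: z_def Fpow_def UN_subset_iff)
    qed
    show "Y \<subseteq> z N" for N by (simp add: z_def)
    fix S assume S: "S \<in> \<S>"
    \<comment> \<open>The cells that make up \<open>S\<close>.\<close>
    define J where "J = {T \<in> Pow \<S>. S \<in> T}"
    have J: "finite J" "J \<subseteq> Pow \<S>" using \<S>(1) by (auto simp: J_def)
    have C_S: "C T N \<inter> S = (if S \<in> T then C T N else {})" for T N
      using C(3)[of T N] S by (auto simp: B_def)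
    have "z N \<inter> S = (Y \<inter> S) \<union> (\<Union>T\<in>J. C T N)" for N
    proof -
      have "z N \<inter> S = (Y \<inter> S) \<union> (\<Union>T\<in>Pow \<S>. C T N \<inter> S)" by (auto simp: z_def)
      also have "(\<Union>T\<in>Pow \<S>. C T N \<inter> S) = (\<Union>T\<in>J. C T N)"
        unfolding C_S J_def by auto
      finally show ?thesis .
    qed
    moreover have "card ((Y \<inter> S) \<union> (\<Union>T\<in>J. C T N)) = card (Y \<inter> S) + (\<Sum>T\<in>J. k T N)" for N
    proof -
      have "card (\<Union>T\<in>J. C T N) = (\<Sum>T\<in>J. card (C T N))"
      proof (intro card_UN_disjoint J ballI impI C(1))
        fix T T' assume "T \<in> J" "T' \<in> J" "T \<noteq> T'"
        then have "B T \<inter> B T' = {}" using disj J(2) by (auto simp: disjoint_family_on_def)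
        then show "C T N \<inter> C T' N = {}" using C(3)[of T N] C(3)[of T' N] by blast
      qed
      moreover have "(Y \<inter> S) \<inter> (\<Union>T\<in>J. C T N) = {}" using C(3) by blast
      ultimately show ?thesis
        using Y(1) C(1,2) J(1) by (subst card_Un_disjoint) auto
    qed
    ultimately have card: "real (card (z N \<inter> S)) / real N =
        real (card (Y \<inter> S)) / real N + (\<Sum>T\<in>J. real (k T N) / real N)" for N
      by (simp add: add_divide_distrib sum_divide_distrib)
    have "(\<Union>T\<in>J. B T) = S"
    proof
      show "(\<Union>T\<in>J. B T) \<subseteq> S" using S by (auto simp: J_def B_def)
      show "S \<subseteq> (\<Union>T\<in>J. B T)"
      proof
        fix x assume x: "x \<in> S"
        then have "{S\<in>\<S>. x \<in> S} \<in> J" "x \<in> B {S\<in>\<S>. x \<in> S}"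
          using S \<S>(2) sets_into_space by (auto simp: J_def B_def)
        then show "x \<in> (\<Union>T\<in>J. B T)" by blast
      qed
    qed
    moreover have "\<mu> (\<Union>T\<in>J. B T) = (\<Sum>T\<in>J. \<mu> (B T))"
      using B by (intro measure_disjoint_UN J(1) disjoint_family_on_mono[OF J(2) disj]) auto
    ultimately have mu: "\<mu> S = 0 + (\<Sum>T\<in>J. \<mu> (B T))" by simp
    show "(\<lambda>N. real (card (z N \<inter> S)) / real N) \<longlonglongrightarrow> \<mu> S"
      unfolding card mu k_def
      by (intro tendsto_add tendsto_sum floor_fraction_tendsto measure_nonneg B
          lim_const_over_n)
  qed
qed

text \<open>
Each generator prescribes at most one point and the frequencies of two sets; every sequence of
finite sets with the right points and limiting frequencies eventually enters it. One sequence of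
proportional samples serves finitely many generators at once.
\<close>

lemma fa_filter_proper: "F \<noteq> bot"
  unfolding fa_filter_def
proof (rule INF_filter_not_bot)
  fix H assume H: "H \<subseteq> generators X \<A> \<mu>" "finite H"
  have "\<forall>G\<in>H. \<exists>Y \<S>. finite Y \<and> Y \<subseteq> X \<and> finite \<S> \<and> \<S> \<subseteq> \<A> \<and>
    (\<forall>z. (\<forall>N. z N \<in> Fpow X \<and> Y \<subseteq> z N) \<and>
      (\<forall>S\<in>\<S>. (\<lambda>N. real (card (z N \<inter> S)) / real N) \<longlonglongrightarrow> \<mu> S) \<longrightarrow>
      (\<forall>\<^sub>F N in sequentially. z N \<in> G))"
  proof
    fix G assume "G \<in> H"
    with H(1) consider x where "x \<in> X" "G = {z \<in> Fpow X. x \<in> z}"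
      | S d a where "S \<in> \<A>" "0 < (d - a) * \<mu> S + a"
        "G = {z \<in> Fpow X. 0 < (\<Sum>x\<in>z. if x \<in> S then d else a)}"
      unfolding generators_def by blast
    then show "\<exists>Y \<S>. finite Y \<and> Y \<subseteq> X \<and> finite \<S> \<and> \<S> \<subseteq> \<A> \<and>
      (\<forall>z. (\<forall>N. z N \<in> Fpow X \<and> Y \<subseteq> z N) \<and>
        (\<forall>S\<in>\<S>. (\<lambda>N. real (card (z N \<inter> S)) / real N) \<longlonglongrightarrow> \<mu> S) \<longrightarrow>
        (\<forall>\<^sub>F N in sequentially. z N \<in> G))"
    proof cases
      case 1
      then show ?thesis by (intro exI[of _ "{x}"] exI[of _ "{}"]) auto
    next
      case (2 S d a)
      \<comment> \<open>Prescribing the frequency of \<open>X\<close> as well makes \<open>card (z N) / N\<close> converge to 1.\<close>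
      have "\<forall>\<^sub>F N in sequentially. z N \<in> G"
        if z: "\<forall>N. z N \<in> Fpow X" and lim: "\<forall>S\<in>{S, X}. (\<lambda>N. real (card (z N \<inter> S)) / real N) \<longlonglongrightarrow> \<mu> S"
        for z
      proof -
        have X: "z N \<inter> X = z N" and fin: "finite (z N)" for N
          using z by (auto simp: Fpow_def)
        have "(\<lambda>N. (d - a) * (real (card (z N \<inter> S)) / real N) + a * (real (card (z N \<inter> X)) / real N))
            \<longlonglongrightarrow> (d - a) * \<mu> S + a * \<mu> X"
          using lim by (intro tendsto_intros) auto
        then have "\<forall>\<^sub>F N in sequentially.
            0 < (d - a) * (real (card (z N \<inter> S)) / real N) + a * (real (card (z N \<inter> X)) / real N)"
          using 2(2) measure_space by (intro order_tendstoD(1)) auto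
        then show ?thesis using eventually_gt_at_top[of 0]
        proof eventually_elim
          case (elim N)
          then have "0 < ((d - a) * real (card (z N \<inter> S)) + a * real (card (z N))) / real N"
            by (simp add: X add_divide_distrib)
          then have "0 < (\<Sum>x\<in>z N. if x \<in> S then d else a)"
            using elim(2) fin by (simp add: step_sum zero_less_divide_iff)
          then show ?case using z 2(3) by simp
        qed
      qed
      then show ?thesis using 2(1)
        by (intro exI[of _ "{}"] exI[of _ "{S, X}"]) auto
    qed
  qed
  from bchoice[OF this] obtain Y where "\<forall>G\<in>H. \<exists>\<S>. finite (Y G) \<and> Y G \<subseteq> X \<and> finite \<S> \<and> \<S> \<subseteq> \<A> \<and>
    (\<forall>z. (\<forall>N. z N \<in> Fpow X \<and> Y G \<subseteq> z N) \<and>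
      (\<forall>S\<in>\<S>. (\<lambda>N. real (card (z N \<inter> S)) / real N) \<longlonglongrightarrow> \<mu> S) \<longrightarrow>
      (\<forall>\<^sub>F N in sequentially. z N \<in> G))" by (elim exE)
  from bchoice[OF this] obtain \<S> where Y\<S>: "\<forall>G\<in>H. finite (Y G) \<and> Y G \<subseteq> X \<and>
    finite (\<S> G) \<and> \<S> G \<subseteq> \<A> \<and>
    (\<forall>z. (\<forall>N. z N \<in> Fpow X \<and> Y G \<subseteq> z N) \<and>
      (\<forall>S\<in>\<S> G. (\<lambda>N. real (card (z N \<inter> S)) / real N) \<longlonglongrightarrow> \<mu> S) \<longrightarrow>
      (\<forall>\<^sub>F N in sequentially. z N \<in> G))" by (elim exE)
  have fin: "finite (\<Union>G\<in>H. \<S> G)" "(\<Union>G\<in>H. \<S> G) \<subseteq> \<A>" "finite (\<Union>G\<in>H. Y G)" "(\<Union>G\<in>H. Y G) \<subseteq> X"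
    using Y\<S> H(2) by blast+
  obtain z where z: "\<And>N. z N \<in> Fpow X" "\<And>N. (\<Union>G\<in>H. Y G) \<subseteq> z N"
    "\<And>S. S \<in> (\<Union>G\<in>H. \<S> G) \<Longrightarrow> (\<lambda>N. real (card (z N \<inter> S)) / real N) \<longlonglongrightarrow> \<mu> S"
    using proportional_samples[OF fin] by blast
  have "\<forall>G\<in>H. \<forall>\<^sub>F N in sequentially. z N \<in> G"
  proof
    fix G assume G: "G \<in> H"
    have "(\<forall>N. z N \<in> Fpow X \<and> Y G \<subseteq> z N) \<and>
      (\<forall>S\<in>\<S> G. (\<lambda>N. real (card (z N \<inter> S)) / real N) \<longlonglongrightarrow> \<mu> S)"
      using z G by blast
    then show "\<forall>\<^sub>F N in sequentially. z N \<in> G" using Y\<S> G by blast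
  qed
  then have "\<forall>\<^sub>F N in sequentially. \<forall>G\<in>H. z N \<in> G"
    using H(2) by (rule eventually_ball_finite[rotated])
  then obtain N where "\<forall>G\<in>H. z N \<in> G" using eventually_happens'[OF sequentially_bot] by blast
  then have "z N \<in> (\<Inter>G\<in>H. G)" by blast
  then show "(INF G\<in>H. principal G) \<noteq> bot"
    unfolding INF_principal_finite[OF H(2)] principal_eq_bot_iff by blast
qed

end

section \<open>Standard parts in a reduced power\<close>

lemma reduced_less_class_iff:
  "reduced_less F (reduced_class F g) (reduced_class F h) \<longleftrightarrow> (\<forall>\<^sub>F z in F. g z < h z)"
proof
  assume "reduced_less F (reduced_class F g) (reduced_class F h)"
  then obtain g' h' where "\<forall>\<^sub>F z in F. g z = g' z" "\<forall>\<^sub>F z in F. h z = h' z" "\<forall>\<^sub>F z in F. g' z < h' z"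
    by (auto simp: reduced_less_def reduced_class_def reduced_rel_def)
  then show "\<forall>\<^sub>F z in F. g z < h z" by eventually_elim simp
next
  assume "\<forall>\<^sub>F z in F. g z < h z"
  then show "reduced_less F (reduced_class F g) (reduced_class F h)"
    unfolding reduced_less_def
    by (intro bexI[of _ g] bexI[of _ h]) (auto simp: reduced_class_def reduced_rel_def)
qed

text \<open>
Limits along \<open>F\<close> are standard parts: by density of the rationals, the rationals
eventually above \<open>g\<close> have infimum \<open>s\<close> and those eventually below it have
supremum \<open>s\<close>.
\<close>

lemma has_st_if_tendsto:
  assumes "F \<noteq> bot" "(g \<longlongrightarrow> s) F"
  shows "has_st F (reduced_class F g) (ereal s)"
  unfolding has_st_def
proof
  let ?A = "{ereal (of_rat q) | q. \<forall>\<^sub>F z in F. g z < of_rat q}"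
  have "Inf ?A = ereal s"
  proof (rule antisym)
    show "ereal s \<le> Inf ?A"
    proof (rule Inf_greatest, clarify)
      fix q assume "\<forall>\<^sub>F z in F. g z < of_rat q"
      then have "\<forall>\<^sub>F z in F. g z \<le> of_rat q" by eventually_elim simp
      then show "ereal s \<le> ereal (of_rat q)"
        using tendsto_upperbound[OF assms(2) _ assms(1)] by simp
    qed
    show "Inf ?A \<le> ereal s"
    proof (rule dense_ge)
      fix y assume "ereal s < y"
      then obtain r where r: "ereal s < ereal r" "ereal r < y" using ereal_dense2 by blast
      then obtain q where q: "s < of_rat q" "of_rat q < r" using of_rat_dense[of s r] by auto
      have "\<forall>\<^sub>F z in F. g z < of_rat q" using assms(2) q(1) by (rule order_tendstoD)
      then have "Inf ?A \<le> ereal (of_rat q)" by (intro Inf_lower) auto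
      also have "\<dots> \<le> y" using q r by (metis ereal_less_eq(3) less_imp_le order_trans)
      finally show "Inf ?A \<le> y" .
    qed
  qed
  then show "st_plus F (reduced_class F g) = ereal s"
    by (simp add: st_plus_def reduced_const_def reduced_less_class_iff)
  let ?B = "{ereal (of_rat q) | q. \<forall>\<^sub>F z in F. of_rat q < g z}"
  have "Sup ?B = ereal s"
  proof (rule antisym)
    show "Sup ?B \<le> ereal s"
    proof (rule Sup_least, clarify)
      fix q assume "\<forall>\<^sub>F z in F. of_rat q < g z"
      then have "\<forall>\<^sub>F z in F. of_rat q \<le> g z" by eventually_elim simp
      then show "ereal (of_rat q) \<le> ereal s"
        using tendsto_lowerbound[OF assms(2) _ assms(1)] by simp
    qed
    show "ereal s \<le> Sup ?B"
    proof (rule dense_le)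
      fix y assume "y < ereal s"
      then obtain r where r: "y < ereal r" "ereal r < ereal s" using ereal_dense2 by blast
      then obtain q where q: "r < of_rat q" "of_rat q < s" using of_rat_dense[of r s] by auto
      have "y \<le> ereal (of_rat q)" using q r by (metis ereal_less_eq(3) less_imp_le order_trans)
      also have "\<forall>\<^sub>F z in F. of_rat q < g z" using assms(2) q(2) by (rule order_tendstoD)
      then have "ereal (of_rat q) \<le> Sup ?B" by (intro Sup_upper) auto
      finally show "y \<le> Sup ?B" .
    qed
  qed
  then show "st_minus F (reduced_class F g) = ereal s"
    by (simp add: st_minus_def reduced_const_def reduced_less_class_iff)
qed

text \<open>
A positive \<open>st\<^sup>-\<close> is witnessed by a positive rational that is eventually below
\<open>g\<close>.
\<close>

lemma eventually_pos_if_has_st: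
  assumes "has_st F (reduced_class F g) (ereal s)" "0 < s"
  shows "\<forall>\<^sub>F z in F. 0 < g z"
proof -
  have "0 < Sup {ereal (of_rat q) | q. \<forall>\<^sub>F z in F. of_rat q < g z}"
    using assms by (simp add: has_st_def st_minus_def reduced_const_def reduced_less_class_iff)
  then obtain q where "0 < ereal (of_rat q)" "\<forall>\<^sub>F z in F. of_rat q < g z"
    by (auto simp: less_Sup_iff)
  then have "(0 :: real) < of_rat q" "\<forall>\<^sub>F z in F. of_rat q < g z" by simp_all
  from this(2) show ?thesis by eventually_elim (rule less_trans[OF \<open>0 < of_rat q\<close>])
qed

section \<open>Averages along the filter\<close>

lemma fa_integral_eqI:
  assumes "has_fa_integral X \<mu> f I" and bound: "\<forall>x\<in>X. \<bar>f x\<bar> < M"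
  shows "fa_integral X \<mu> f = I"
  unfolding fa_integral_def
proof (rule the_equality)
  fix J assume "has_fa_integral X \<mu> f J"
  then have "fa_lower X \<mu> f M \<longlonglongrightarrow> J" "fa_lower X \<mu> f M \<longlonglongrightarrow> I"
    using assms unfolding has_fa_integral_def by blast+
  then show "J = I" by (rule LIMSEQ_unique)
qed fact

context fa_space
begin

text \<open>
Replacing \<open>f\<close> by the constant \<open>c i\<close> on the \<open>i\<close>-th slice
changes its average over any finite set by at most \<open>M / n\<close>, and the average of the
resulting simple function converges to the displayed sum, as frequencies converge to measures.
Both the lower and the upper sums have this shape.
\<close>

lemma average_near_slice_sum:
  assumes f: "fa_measurable X \<A> f" and bound: "\<forall>x\<in>X. \<bar>f x\<bar> < M" and n: "0 < n"
    and c: "\<And>i x. x \<in> fa_slice X f M n i \<Longrightarrow> \<bar>f x - c i\<bar> \<le> M / real n"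
  shows "\<forall>\<^sub>F z in F. \<bar>(\<Sum>x\<in>z. f x) / real (card z) -
    (\<Sum>i\<in>{- int n..<int n}. c i * \<mu> (fa_slice X f M n i))\<bar> \<le> 2 * M / real n"
proof -
  let ?I = "{- int n..<int n}"
  have M: "0 < M"
    using space_nonempty bound by (metis abs_ge_zero all_not_in_conv le_less_trans)
  \<comment> \<open>The slices are half-open on the left, so the index of the slice of \<open>x\<close> is a ceiling minus 1.\<close>
  define g where "g x = \<lceil>f x * real n / M\<rceil> - 1" for x
  have slice: "x \<in> fa_slice X f M n i \<longleftrightarrow> g x = i" if "x \<in> X" for x i
  proof -
    have "g x = i \<longleftrightarrow> of_int i < f x * real n / M \<and> f x * real n / M \<le> of_int (i + 1)"
      unfolding g_def using ceiling_eq_iff[of "f x * real n / M" "i + 1"] by auto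
    also have "\<dots> \<longleftrightarrow> x \<in> fa_slice X f M n i"
      using that M n by (simp add: fa_slice_def field_simps)
    finally show ?thesis by blast
  qed
  have g_range: "g x \<in> ?I" if "x \<in> X" for x
  proof -
    have "- M < f x" "f x < M" using bspec[OF bound that] by linarith+
    then have "- M * real n < f x * real n" "f x * real n < M * real n"
      using n by (simp_all only: mult_strict_right_mono of_nat_0_less_iff)
    then have "- real n < f x * real n / M" "f x * real n / M < real n"
      using M by (simp_all add: less_divide_eq divide_less_eq mult.commute)
    then have "- int n < \<lceil>f x * real n / M\<rceil>" "\<lceil>f x * real n / M\<rceil> \<le> int n"
      by (simp_all add: less_ceiling_iff ceiling_le_iff)
    then show ?thesis unfolding g_def by simp
  qed
  have meas: "fa_slice X f M n i \<in> \<A>" for i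
    unfolding fa_slice_def using f M n
    by (simp add: fa_measurable_def divide_strict_right_mono)
  have "((\<lambda>z. \<Sum>i\<in>?I. c i * (real (card (z \<inter> fa_slice X f M n i)) / real (card z))) \<longlongrightarrow>
      (\<Sum>i\<in>?I. c i * \<mu> (fa_slice X f M n i))) F"
    by (intro tendsto_sum tendsto_mult tendsto_const frequency_tendsto meas)
  then have "\<forall>\<^sub>F z in F. dist (\<Sum>i\<in>?I. c i * (real (card (z \<inter> fa_slice X f M n i)) / real (card z)))
      (\<Sum>i\<in>?I. c i * \<mu> (fa_slice X f M n i)) < M / real n"
    by (rule tendstoD) (use M n in simp)
  with eventually_nonempty show ?thesis
  proof eventually_elim
    case (elim z)
    then have z: "finite z" "z \<subseteq> X" "0 < real (card z)" by (auto simp: Fpow_def card_gt_0_iff)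
    have "(\<Sum>x\<in>z. c (g x)) = (\<Sum>i\<in>?I. \<Sum>x\<in>{x \<in> z. g x = i}. c (g x))"
      using z g_range by (intro sum.group[symmetric]) auto
    also have "\<dots> = (\<Sum>i\<in>?I. c i * real (card (z \<inter> fa_slice X f M n i)))"
    proof (rule sum.cong[OF refl])
      fix i
      have "{x \<in> z. g x = i} = z \<inter> fa_slice X f M n i" using slice z(2) by blast
      moreover have "(\<Sum>x\<in>{x \<in> z. g x = i}. c (g x)) = (\<Sum>x\<in>{x \<in> z. g x = i}. c i)"
        by (rule sum.cong) auto
      ultimately show "(\<Sum>x\<in>{x \<in> z. g x = i}. c (g x)) = c i * real (card (z \<inter> fa_slice X f M n i))"
        by simp
    qed
    finally have "(\<Sum>i\<in>?I. c i * (real (card (z \<inter> fa_slice X f M n i)) / real (card z))) =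
        (\<Sum>x\<in>z. c (g x)) / real (card z)"
      by (simp add: sum_divide_distrib)
    moreover have "\<bar>(\<Sum>x\<in>z. f x) / real (card z) - (\<Sum>x\<in>z. c (g x)) / real (card z)\<bar> \<le> M / real n"
    proof -
      have "\<bar>\<Sum>x\<in>z. f x - c (g x)\<bar> \<le> (\<Sum>x\<in>z. \<bar>f x - c (g x)\<bar>)" by (rule sum_abs)
      also have "\<dots> \<le> real (card z) * (M / real n)"
      proof (rule sum_bounded_above)
        fix x assume "x \<in> z"
        then have "x \<in> fa_slice X f M n (g x)" using slice z(2) by blast
        then show "\<bar>f x - c (g x)\<bar> \<le> M / real n" by (rule c)
      qed
      finally have "\<bar>\<Sum>x\<in>z. f x - c (g x)\<bar> / real (card z) \<le> M / real n"
        using z(3) by (simp add: divide_le_eq mult.commute)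
      then show ?thesis
        using z(3) by (simp add: sum_subtractf abs_divide flip: diff_divide_distrib)
    qed
    ultimately show ?case using elim(2) by (simp add: dist_real_def)
  qed
qed

lemma average_near_lower_upper:
  assumes "fa_measurable X \<A> f" "\<forall>x\<in>X. \<bar>f x\<bar> < M" "0 < n"
  shows "\<forall>\<^sub>F z in F. \<bar>(\<Sum>x\<in>z. f x) / real (card z) - fa_lower X \<mu> f M n\<bar> \<le> 2 * M / real n"
    and "\<forall>\<^sub>F z in F. \<bar>(\<Sum>x\<in>z. f x) / real (card z) - fa_upper X \<mu> f M n\<bar> \<le> 2 * M / real n"
proof -
  have width: "M * (of_int i + 1) / real n = M * of_int i / real n + M / real n" for i
    by (simp add: distrib_left add_divide_distrib)
  show "\<forall>\<^sub>F z in F. \<bar>(\<Sum>x\<in>z. f x) / real (card z) - fa_lower X \<mu> f M n\<bar> \<le> 2 * M / real n"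
    unfolding fa_lower_def
    by (rule average_near_slice_sum[OF assms]) (auto simp: fa_slice_def width abs_le_iff)
  show "\<forall>\<^sub>F z in F. \<bar>(\<Sum>x\<in>z. f x) / real (card z) - fa_upper X \<mu> f M n\<bar> \<le> 2 * M / real n"
    unfolding fa_upper_def
    by (rule average_near_slice_sum[OF assms]) (auto simp: fa_slice_def width abs_le_iff)
qed

lemma fa_measurable_step:
  assumes S: "S \<in> \<A>"
  shows "fa_measurable X \<A> (\<lambda>x. if x \<in> S then d else a)"
  unfolding fa_measurable_def
proof (intro allI impI)
  fix u v :: real
  have "{x \<in> X. u < (if x \<in> S then d else a) \<and> (if x \<in> S then d else a) \<le> v} =
      (if u < d \<and> d \<le> v then S else {}) \<union> (if u < a \<and> a \<le> v then X - S else {})"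
    using sets_into_space[OF S] by auto
  then show "{x \<in> X. u < (if x \<in> S then d else a) \<and> (if x \<in> S then d else a) \<le> v} \<in> \<A>"
    using S by (auto intro!: Un)
qed

end

context diffuse_fa_space
begin

text \<open>
Two lower sums are both close to the same averages eventually, and as the filter is proper, they
are close to each other. Hence the lower sums are Cauchy, and their limit is the limit of the
averages.
\<close>

lemma ex_average_limit:
  assumes f: "fa_measurable X \<A> f" and bound: "\<forall>x\<in>X. \<bar>f x\<bar> < M"
  shows "\<exists>I. ((\<lambda>z. (\<Sum>x\<in>z. f x) / real (card z)) \<longlongrightarrow> I) F"
proof -
  let ?v = "fa_lower X \<mu> f M" and ?avg = "\<lambda>z. (\<Sum>x\<in>z. f x) / real (card z)"
  have rate: "(\<lambda>n. 2 * M / real n) \<longlonglongrightarrow> 0" by (rule lim_const_over_n)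
  have near: "\<bar>?v m - ?v n\<bar> \<le> 2 * M / real m + 2 * M / real n" if "0 < m" "0 < n" for m n
  proof -
    have "\<forall>\<^sub>F z in F. \<bar>?v m - ?v n\<bar> \<le> 2 * M / real m + 2 * M / real n"
      using average_near_lower_upper(1)[OF f bound that(1)] average_near_lower_upper(1)[OF f bound that(2)]
      by eventually_elim linarith
    then show ?thesis using fa_filter_proper by (simp add: eventually_const_iff)
  qed
  have "Cauchy ?v"
  proof (rule metric_CauchyI)
    fix e :: real assume "0 < e"
    then have "\<forall>\<^sub>F n in sequentially. 2 * M / real n < e / 2 \<and> 0 < n"
      by (intro eventually_conj order_tendstoD(2)[OF rate] eventually_gt_at_top) auto
    then obtain K where K: "\<And>n. K \<le> n \<Longrightarrow> 2 * M / real n < e / 2 \<and> 0 < n"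
      by (auto simp: eventually_sequentially)
    show "\<exists>K. \<forall>m\<ge>K. \<forall>n\<ge>K. dist (?v m) (?v n) < e"
    proof (intro exI[of _ K] allI impI)
      fix m n assume "K \<le> m" "K \<le> n"
      then show "dist (?v m) (?v n) < e"
        using near[of m n] K[of m] K[of n] by (simp add: dist_real_def)
    qed
  qed
  then obtain I where I: "?v \<longlonglongrightarrow> I" using Cauchy_convergent convergent_def by blast
  have "(?avg \<longlongrightarrow> I) F"
  proof (rule tendstoI)
    fix e :: real assume "0 < e"
    then have "\<forall>\<^sub>F n in sequentially. 2 * M / real n < e / 2 \<and> dist (?v n) I < e / 2 \<and> 0 < n"
      by (intro eventually_conj order_tendstoD(2)[OF rate] tendstoD[OF I] eventually_gt_at_top) auto
    then obtain n where n: "2 * M / real n < e / 2" "dist (?v n) I < e / 2" "0 < n"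
      using eventually_happens'[OF sequentially_bot] by blast
    from average_near_lower_upper(1)[OF f bound n(3)]
    show "\<forall>\<^sub>F z in F. dist (?avg z) I < e"
    proof eventually_elim
      case (elim z)
      then show ?case using n(1,2) unfolding dist_real_def by linarith
    qed
  qed
  then show ?thesis by blast
qed

text \<open>
The averages do not depend on the bound \<open>M\<close>, so their limit is the limit of the lower
and upper sums for every admissible \<open>M\<close>.
\<close>

lemma has_fa_integral_if_average_tendsto:
  assumes f: "fa_measurable X \<A> f"
    and I: "((\<lambda>z. (\<Sum>x\<in>z. f x) / real (card z)) \<longlongrightarrow> I) F"
  shows "has_fa_integral X \<mu> f I"
  unfolding has_fa_integral_def
proof (intro allI impI)
  fix M assume "\<forall>x\<in>X. \<bar>f x\<bar> < M"
  then have bound: "\<forall>x\<in>X. \<bar>f x\<bar> < M" by blast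
  have near: "\<bar>I - v\<bar> \<le> e"
    if "\<forall>\<^sub>F z in F. \<bar>(\<Sum>x\<in>z. f x) / real (card z) - v\<bar> \<le> e" for v e
    using tendsto_upperbound[OF tendsto_rabs[OF tendsto_diff[OF I tendsto_const]] that fa_filter_proper] .
  have lim: "v \<longlonglongrightarrow> I" if "\<And>n. 0 < n \<Longrightarrow> \<bar>I - v n\<bar> \<le> 2 * M / real n" for v
  proof (rule LIM_zero_cancel, rule Lim_null_comparison)
    show "\<forall>\<^sub>F n in sequentially. norm (v n - I) \<le> 2 * M / real n"
      using eventually_gt_at_top[of 0] by eventually_elim (simp add: that abs_minus_commute)
    show "(\<lambda>n. 2 * M / real n) \<longlonglongrightarrow> 0" by (rule lim_const_over_n)
  qed
  show "fa_lower X \<mu> f M \<longlonglongrightarrow> I \<and> fa_upper X \<mu> f M \<longlonglongrightarrow> I"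
    using average_near_lower_upper[OF f bound] by (intro conjI lim near)
qed

lemma average_tendsto_fa_integral:
  assumes f: "fa_measurable X \<A> f" and "bounded (f ` X)"
  shows "((\<lambda>z. (\<Sum>x\<in>z. f x) / real (card z)) \<longlongrightarrow> fa_integral X \<mu> f) F"
proof -
  obtain B where B: "\<And>x. x \<in> X \<Longrightarrow> \<bar>f x\<bar> \<le> B" using assms(2) by (auto simp: bounded_iff)
  then have bound: "\<forall>x\<in>X. \<bar>f x\<bar> < B + 1" by force
  obtain I where I: "((\<lambda>z. (\<Sum>x\<in>z. f x) / real (card z)) \<longlongrightarrow> I) F"
    using ex_average_limit[OF f bound] by blast
  then have "fa_integral X \<mu> f = I"
    by (intro fa_integral_eqI[OF _ bound] has_fa_integral_if_average_tendsto[OF f])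
  then show ?thesis using I by simp
qed

text \<open>
The integral and the elementary expression are both limits of the averages along the proper
filter, which spares a computation with lower sums.
\<close>

lemma fa_integral_step:
  assumes S: "S \<in> \<A>"
  shows "fa_integral X \<mu> (\<lambda>x. if x \<in> S then d else a) = (d - a) * \<mu> S + a"
proof (rule tendsto_unique[OF fa_filter_proper])
  show "((\<lambda>z. (\<Sum>x\<in>z. if x \<in> S then d else a) / real (card z)) \<longlongrightarrow>
      fa_integral X \<mu> (\<lambda>x. if x \<in> S then d else a)) F"
    by (rule average_tendsto_fa_integral[OF fa_measurable_step[OF S]])
      (auto simp: bounded_iff intro!: exI[of _ "max \<bar>d\<bar> \<bar>a\<bar>"])
  have "((\<lambda>z. (d - a) * (real (card (z \<inter> S)) / real (card z)) + a) \<longlongrightarrow> (d - a) * \<mu> S + a) F"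
    by (intro tendsto_intros frequency_tendsto S)
  moreover have "\<forall>\<^sub>F z in F. (d - a) * (real (card (z \<inter> S)) / real (card z)) + a =
      (\<Sum>x\<in>z. if x \<in> S then d else a) / real (card z)"
    using eventually_nonempty
  proof eventually_elim
    case (elim z)
    then have "finite z" "real (card z) \<noteq> 0" by (auto simp: Fpow_def)
    then show ?case by (simp add: step_sum add_divide_distrib)
  qed
  ultimately show "((\<lambda>z. (\<Sum>x\<in>z. if x \<in> S then d else a) / real (card z)) \<longlongrightarrow>
      (d - a) * \<mu> S + a) F"
    by (rule Lim_transform_eventually)
qed

lemma integrates_fa_filter: "integrates X \<A> \<mu> F"
  unfolding integrates_def filter_integral_def
  by (auto intro!: fa_filter_proper has_st_if_tendsto average_tendsto_fa_integral)

lemma fine_fa_filter: "fine_filter X F"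
  unfolding fine_filter_def using eventually_nonempty eventually_member
  by (simp add: eventually_conj_iff fa_filter_proper)

text \<open>
The order \<open>\<le>\<close> on filters reverses inclusion: every generator belongs to
\<open>F'\<close>, since the average of the two-valued function has the positive standard part
\<open>(d - a) \<mu> S + a\<close>.
\<close>

lemma le_fa_filter:
  assumes fine: "fine_filter X F'" and int: "integrates X \<A> \<mu> F'"
  shows "F' \<le> F"
  unfolding fa_filter_def
proof (rule INF_greatest)
  fix G assume "G \<in> generators X \<A> \<mu>"
  then consider x where "x \<in> X" "G = {z \<in> Fpow X. x \<in> z}"
    | S d a where "S \<in> \<A>" "0 < (d - a) * \<mu> S + a"
      "G = {z \<in> Fpow X. 0 < (\<Sum>x\<in>z. if x \<in> S then d else a)}"
    unfolding generators_def by blast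
  then show "F' \<le> principal G"
  proof cases
    case 1
    then show ?thesis using fine by (simp add: le_principal fine_filter_def eventually_conj)
  next
    case (2 S d a)
    let ?f = "\<lambda>x. if x \<in> S then d else a"
    have "bounded (?f ` X)"
      by (auto simp: bounded_iff intro!: exI[of _ "max \<bar>d\<bar> \<bar>a\<bar>"])
    then have "has_st F' (filter_integral ?f F') (ereal (fa_integral X \<mu> ?f))"
      using int fa_measurable_step[OF 2(1)] unfolding integrates_def by blast
    then have "\<forall>\<^sub>F z in F'. 0 < (\<Sum>x\<in>z. ?f x) / real (card z)"
      unfolding filter_integral_def fa_integral_step[OF 2(1)]
      using 2(2) by (rule eventually_pos_if_has_st)
    moreover have "\<forall>\<^sub>F z in F'. z \<in> Fpow X" using fine by (simp add: fine_filter_def)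
    ultimately show ?thesis unfolding le_principal 2(3)
    proof eventually_elim
      case (elim z)
      then show ?case by (auto simp: zero_less_divide_iff)
    qed
  qed
qed

end

section \<open>Relations expressible by first-order formulas\<close>

text \<open>
A predicate on assignments is expressible if it depends on finitely many variables only and, under
every renaming \<open>\<rho>\<close> of the variables, is defined by some formula. Quantifying
over all renamings builds substitution into the notion: the bound variable of a quantifier can be
given a fresh name without any renaming of formulas.
\<close>

definition expressible ::
    "('a + real) V4 set \<Rightarrow> ((nat \<Rightarrow> ('a + real) V4) \<Rightarrow> bool) \<Rightarrow> bool" where
  "expressible U P \<longleftrightarrow>
     (\<exists>N. \<forall>e e'. (\<forall>i<N. e i = e' i) \<longrightarrow> P e = P e') \<and>
     (\<forall>\<rho>. \<exists>\<phi>. \<forall>e. range e \<subseteq> U \<longrightarrow> (sat U e \<phi> \<longleftrightarrow> P (\<lambda>i. e (\<rho> i))))"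

definition is_less :: "('a + real) V4 \<Rightarrow> ('a + real) V4 \<Rightarrow> bool" where
  "is_less u v \<longleftrightarrow> (\<exists>r s. u = Atom (Inr r) \<and> v = Atom (Inr s) \<and> r < s)"

definition is_sum :: "('a + real) V4 \<Rightarrow> ('a + real) V4 \<Rightarrow> ('a + real) V4 \<Rightarrow> bool" where
  "is_sum u v w \<longleftrightarrow>
     (\<exists>r s. u = Atom (Inr r) \<and> v = Atom (Inr s) \<and> w = Atom (Inr (r + s)))"

definition is_prod :: "('a + real) V4 \<Rightarrow> ('a + real) V4 \<Rightarrow> ('a + real) V4 \<Rightarrow> bool" where
  "is_prod u v w \<longleftrightarrow>
     (\<exists>r s. u = Atom (Inr r) \<and> v = Atom (Inr s) \<and> w = Atom (Inr (r * s)))"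

named_theorems express "closure properties of expressibility"

lemma expressible_atomic:
  assumes "\<And>e e'. e i = e' i \<Longrightarrow> e j = e' j \<Longrightarrow> e k = e' k \<Longrightarrow> P e = P e'"
    and "\<And>\<rho> e. sat U e (\<phi> \<rho>) \<longleftrightarrow> P (\<lambda>i. e (\<rho> i))"
  shows "expressible U P"
  unfolding expressible_def
proof (intro conjI allI)
  show "\<exists>N. \<forall>e e'. (\<forall>i<N. e i = e' i) \<longrightarrow> P e = P e'"
    by (intro exI[of _ "Suc (i + j + k)"] allI impI assms(1)) auto
  show "\<exists>\<phi>. \<forall>e. range e \<subseteq> U \<longrightarrow> (sat U e \<phi> \<longleftrightarrow> P (\<lambda>i. e (\<rho> i)))" for \<rho>
    using assms(2)[of _ \<rho>] by blast
qed

lemma expressible_mem [express]: "expressible U (\<lambda>e. e i \<in> members (e j))"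
  by (rule expressible_atomic[of i j i _ _ "\<lambda>\<rho>. Mem (\<rho> i) (\<rho> j)"]) simp_all

lemma expressible_eq [express]: "expressible U (\<lambda>e. e i = e j)"
  by (rule expressible_atomic[of i j i _ _ "\<lambda>\<rho>. Eq (\<rho> i) (\<rho> j)"]) simp_all

lemma expressible_less [express]: "expressible U (\<lambda>e. is_less (e i) (e j))"
  unfolding is_less_def
  by (rule expressible_atomic[of i j i _ _ "\<lambda>\<rho>. Less (\<rho> i) (\<rho> j)"]) simp_all

lemma expressible_sum [express]: "expressible U (\<lambda>e. is_sum (e i) (e j) (e k))"
  unfolding is_sum_def
  by (rule expressible_atomic[of i j k _ _ "\<lambda>\<rho>. Plus (\<rho> i) (\<rho> j) (\<rho> k)"]) simp_all

lemma expressible_prod [express]: "expressible U (\<lambda>e. is_prod (e i) (e j) (e k))"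
  unfolding is_prod_def
  by (rule expressible_atomic[of i j k _ _ "\<lambda>\<rho>. Times (\<rho> i) (\<rho> j) (\<rho> k)"]) simp_all

lemma expressibleD:
  assumes "expressible U P"
  shows "\<exists>N. \<forall>e e'. (\<forall>i<N. e i = e' i) \<longrightarrow> P e = P e'"
    and "\<exists>\<phi>. \<forall>e. range e \<subseteq> U \<longrightarrow> (sat U e \<phi> \<longleftrightarrow> P (\<lambda>i. e (\<rho> i)))"
proof -
  note assms[unfolded expressible_def]
  from conjunct1[OF this] show "\<exists>N. \<forall>e e'. (\<forall>i<N. e i = e' i) \<longrightarrow> P e = P e'" .
  from spec[OF conjunct2[OF assms[unfolded expressible_def]], of \<rho>]
  show "\<exists>\<phi>. \<forall>e. range e \<subseteq> U \<longrightarrow> (sat U e \<phi> \<longleftrightarrow> P (\<lambda>i. e (\<rho> i)))" .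
qed

lemma expressible_not [express]:
  assumes "expressible U P"
  shows "expressible U (\<lambda>e. \<not> P e)"
  unfolding expressible_def
proof (intro conjI allI)
  obtain N where N: "\<forall>e e'. (\<forall>i<N. e i = e' i) \<longrightarrow> P e = P e'"
    using expressibleD(1)[OF assms] by (elim exE)
  show "\<exists>N. \<forall>e e'. (\<forall>i<N. e i = e' i) \<longrightarrow> (\<not> P e) = (\<not> P e')"
    by (intro exI[of _ N] allI impI arg_cong[where f = Not] N[rule_format]) auto
  fix \<rho> :: "nat \<Rightarrow> nat"
  obtain \<phi> where "\<forall>e. range e \<subseteq> U \<longrightarrow> (sat U e \<phi> \<longleftrightarrow> P (\<lambda>i. e (\<rho> i)))"
    using expressibleD(2)[OF assms, of \<rho>] by (elim exE)
  then show "\<exists>\<phi>. \<forall>e. range e \<subseteq> U \<longrightarrow> (sat U e \<phi> \<longleftrightarrow> \<not> P (\<lambda>i. e (\<rho> i)))"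
    by (intro exI[of _ "Neg \<phi>"]) auto
qed

lemma expressible_conj [express]:
  assumes "expressible U P" "expressible U Q"
  shows "expressible U (\<lambda>e. P e \<and> Q e)"
  unfolding expressible_def
proof (intro conjI allI)
  obtain M N where M: "\<forall>e e'. (\<forall>i<M. e i = e' i) \<longrightarrow> P e = P e'"
    and N: "\<forall>e e'. (\<forall>i<N. e i = e' i) \<longrightarrow> Q e = Q e'"
    using expressibleD(1)[OF assms(1)] expressibleD(1)[OF assms(2)] by (elim exE)
  show "\<exists>N. \<forall>e e'. (\<forall>i<N. e i = e' i) \<longrightarrow> (P e \<and> Q e) = (P e' \<and> Q e')"
  proof (intro exI[of _ "max M N"] allI impI)
    fix e e' :: "nat \<Rightarrow> ('a + real) V4" assume "\<forall>i<max M N. e i = e' i"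
    then have "\<forall>i<M. e i = e' i" "\<forall>i<N. e i = e' i" by simp_all
    then have "P e = P e'" "Q e = Q e'" using M N by blast+
    then show "(P e \<and> Q e) = (P e' \<and> Q e')" by simp
  qed
  fix \<rho> :: "nat \<Rightarrow> nat"
  obtain \<phi> \<psi> where "\<forall>e. range e \<subseteq> U \<longrightarrow> (sat U e \<phi> \<longleftrightarrow> P (\<lambda>i. e (\<rho> i)))"
    and "\<forall>e. range e \<subseteq> U \<longrightarrow> (sat U e \<psi> \<longleftrightarrow> Q (\<lambda>i. e (\<rho> i)))"
    using expressibleD(2)[OF assms(1), of \<rho>] expressibleD(2)[OF assms(2), of \<rho>] by (elim exE)
  then show "\<exists>\<phi>. \<forall>e. range e \<subseteq> U \<longrightarrow>
      (sat U e \<phi> \<longleftrightarrow> P (\<lambda>i. e (\<rho> i)) \<and> Q (\<lambda>i. e (\<rho> i)))"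
    by (intro exI[of _ "Conj \<phi> \<psi>"]) auto
qed

lemma expressible_disj [express]:
  assumes "expressible U P" "expressible U Q"
  shows "expressible U (\<lambda>e. P e \<or> Q e)"
proof -
  have "expressible U (\<lambda>e. \<not> (\<not> P e \<and> \<not> Q e))" by (intro express assms)
  then show ?thesis by simp
qed

lemma expressible_imp [express]:
  assumes "expressible U P" "expressible U Q"
  shows "expressible U (\<lambda>e. P e \<longrightarrow> Q e)"
proof -
  have "expressible U (\<lambda>e. \<not> P e \<or> Q e)" by (intro express assms)
  then show ?thesis by (simp only: imp_conv_disj)
qed

lemma expressible_iff [express]:
  assumes "expressible U P" "expressible U Q"
  shows "expressible U (\<lambda>e. P e \<longleftrightarrow> Q e)"
proof -
  have "expressible U (\<lambda>e. (P e \<longrightarrow> Q e) \<and> (Q e \<longrightarrow> P e))" by (intro express assms)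
  then show ?thesis by (simp only: iff_conv_conj_imp)
qed

text \<open>
The bound variable is the new variable 0 and the others are shifted by one, as with de Bruijn
indices. In this form the rule has no freshness condition, and together with the other rules it
proves expressibility by backward chaining alone. The fresh name is chosen outside the finitely
many variables on which the predicate depends.
\<close>

lemma expressible_ball [express]:
  assumes "expressible U (\<lambda>e. P (\<lambda>i. e (Suc i)) (e 0))"
  shows "expressible U (\<lambda>e. \<forall>u\<in>U. P e u)"
  unfolding expressible_def
proof (intro conjI allI)
  obtain N where N: "\<forall>e e'. (\<forall>i<N. e i = e' i) \<longrightarrow>
      P (\<lambda>i. e (Suc i)) (e 0) = P (\<lambda>i. e' (Suc i)) (e' 0)"
    using expressibleD(1)[OF assms] by (elim exE)
  have supp: "P e u = P e' u" if "\<forall>i<N. e i = e' i" for e e' u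
  proof -
    have "\<forall>i<N. case_nat u e i = case_nat u e' i" using that by (auto split: nat.split)
    from N[THEN spec, THEN spec, THEN mp, OF this] show ?thesis by simp
  qed
  show "\<exists>N. \<forall>e e'. (\<forall>i<N. e i = e' i) \<longrightarrow> (\<forall>u\<in>U. P e u) = (\<forall>u\<in>U. P e' u)"
    by (rule exI[of _ N]) (intro allI impI ball_cong refl, erule supp)
  fix \<rho> :: "nat \<Rightarrow> nat"
  obtain k where k: "k \<notin> \<rho> ` {..<N}"
    using ex_new_if_finite[OF infinite_UNIV_nat] by blast
  obtain \<phi> where \<phi>: "\<forall>e. range e \<subseteq> U \<longrightarrow> (sat U e \<phi> \<longleftrightarrow> P (\<lambda>i. e (\<rho> i)) (e k))"
    using expressibleD(2)[OF assms, of "case_nat k \<rho>"] by auto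
  show "\<exists>\<phi>. \<forall>e. range e \<subseteq> U \<longrightarrow> (sat U e \<phi> \<longleftrightarrow> (\<forall>u\<in>U. P (\<lambda>i. e (\<rho> i)) u))"
  proof (intro exI[of _ "All k \<phi>"] allI impI)
    fix e :: "nat \<Rightarrow> ('a + real) V4" assume e: "range e \<subseteq> U"
    have "sat U (e(k := u)) \<phi> \<longleftrightarrow> P (\<lambda>i. e (\<rho> i)) u" if "u \<in> U" for u
    proof -
      have "sat U (e(k := u)) \<phi> \<longleftrightarrow> P (\<lambda>i. (e(k := u)) (\<rho> i)) ((e(k := u)) k)"
        using e that by (intro \<phi>[rule_format]) auto
      also have "\<dots> \<longleftrightarrow> P (\<lambda>i. e (\<rho> i)) u"
        unfolding fun_upd_same using k by (intro supp) auto
      finally show ?thesis .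
    qed
    then show "sat U e (All k \<phi>) \<longleftrightarrow> (\<forall>u\<in>U. P (\<lambda>i. e (\<rho> i)) u)" by simp
  qed
qed

lemma expressible_bex [express]:
  assumes "expressible U (\<lambda>e. P (\<lambda>i. e (Suc i)) (e 0))"
  shows "expressible U (\<lambda>e. \<exists>u\<in>U. P e u)"
proof -
  have "expressible U (\<lambda>e. \<not> (\<forall>u\<in>U. \<not> P e u))" by (intro express assms)
  then show ?thesis by simp
qed

lemma definable_fromI:
  assumes "p \<in> U" "y \<in> U" and P: "expressible U (\<lambda>e. P (e 1) (e 0))"
    and "\<And>u. u \<in> U \<Longrightarrow> P p u \<longleftrightarrow> u = y"
  shows "definable_from U p y"
proof -
  obtain \<phi> where "\<forall>e. range e \<subseteq> U \<longrightarrow> (sat U e \<phi> \<longleftrightarrow> P (e 1) (e 0))"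
    using expressibleD(2)[OF P, of "\<lambda>i. i"] by auto
  then show ?thesis
    unfolding definable_from_def using assms(1,2,4)
    by (intro conjI exI[of _ \<phi>] allI impI) (auto simp: image_subset_iff)
qed

section \<open>Codes of sets, relations and families\<close>

lemma Atom_in_next_level [simp]: "Atom b \<in> next_level B D \<longleftrightarrow> b \<in> B"
  by (auto simp: next_level_def)

lemma Coll_in_next_level [simp]: "Coll S \<in> next_level B D \<longleftrightarrow> S \<subseteq> D"
  by (auto simp: next_level_def)

lemma lift_node_next_level:
  "u \<in> next_level B D \<Longrightarrow> (\<And>x. x \<in> D \<Longrightarrow> h x \<in> D') \<Longrightarrow> lift_node h u \<in> next_level B D'"
  by (cases u) auto

lemma members_universe:
  assumes "u \<in> universe X"
  shows "members u \<subseteq> universe X"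
proof -
  define B where "B = (Inl ` X \<union> range Inr :: ('a + real) set)"
  have U: "universe X = next_level B (next_level B (next_level B (next_level B B)))"
    by (simp add: universe_def B_def Let_def)
  have incl: "incl v \<in> universe X" if "v \<in> next_level B (next_level B (next_level B B))" for v
    unfolding U incl_def
    by (rule lift_node_next_level[OF that]) (erule lift_node_next_level, erule lift_node_next_level, simp)
  show ?thesis
  proof (cases u)
    case (Coll S)
    then have "S \<subseteq> next_level B (next_level B (next_level B B))" using assms by (simp add: U)
    then show ?thesis using incl Coll by auto
  qed simp
qed

definition set_code :: "'a set \<Rightarrow> ('a + real) V4" where
  "set_code z = Coll ((\<lambda>x. Atom (Inl x)) ` z)"

definition coll_code :: "'a set set \<Rightarrow> ('a + real) V4" where
  "coll_code W = Coll ((\<lambda>z. Coll ((\<lambda>x. Atom (Inl x)) ` z)) ` W)"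

definition rel_code :: "('a set \<times> real) set \<Rightarrow> ('a + real) V4" where
  "rel_code R = Coll ((\<lambda>(z, r). kpair (Coll (Inl ` z)) (Atom (Inr r))) ` R)"

lemma code_measure_eq: "code_measure \<A> \<mu> = rel_code ((\<lambda>S. (S, \<mu> S)) ` \<A>)"
  by (simp add: code_measure_def rel_code_def image_image)

lemma members_set_code [simp]: "members (set_code z) = (\<lambda>x. Atom (Inl x)) ` z"
  by (simp add: set_code_def incl_def image_image)

lemma members_coll_code [simp]: "members (coll_code W) = set_code ` W"
  by (simp add: coll_code_def set_code_def incl_def image_image)

lemma members_code_family [simp]: "members (code_family \<F>) = coll_code ` \<F>"
  by (simp add: code_family_def coll_code_def incl_def image_image)

lemma set_code_eq_iff [simp]: "set_code z = set_code z' \<longleftrightarrow> z = z'"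
  by (auto simp: set_code_def inj_image_eq_iff inj_on_def)

lemma real_in_universe [simp]: "Atom (Inr r) \<in> universe X"
  by (simp add: universe_def Let_def)

lemma point_in_universe [simp]: "Atom (Inl x) \<in> universe X \<longleftrightarrow> x \<in> X"
  by (auto simp: universe_def Let_def)

lemma set_code_in_universe [simp]: "z \<subseteq> X \<Longrightarrow> set_code z \<in> universe X"
  by (auto simp: set_code_def universe_def Let_def)

lemma coll_code_in_universe [simp]: "W \<subseteq> Pow X \<Longrightarrow> coll_code W \<in> universe X"
  by (auto simp: coll_code_def universe_def Let_def image_subset_iff)

lemma code_family_in_universe [simp]: "\<F> \<subseteq> Pow (Pow X) \<Longrightarrow> code_family \<F> \<in> universe X"
  by (auto simp: code_family_def universe_def Let_def image_subset_iff)

lemma rel_code_in_universe [simp]: "fst ` R \<subseteq> Pow X \<Longrightarrow> rel_code R \<in> universe X"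
  by (fastforce simp: rel_code_def kpair_def universe_def Let_def image_subset_iff)

text \<open>
Extensionality. An atom and the empty collection have the same members, which is why nonempty
members are assumed.
\<close>

lemma universe_eqI:
  assumes "u \<in> universe X" "v \<in> universe X" "members u = members v" "members v \<noteq> {}"
  shows "u = v"
proof -
  have inj: "inj (lift_node h :: ('b, 'c) node \<Rightarrow> ('b, 'd) node)" if "inj h" for h :: "'c \<Rightarrow> 'd"
  proof (rule injI)
    fix x y :: "('b, 'c) node" assume "lift_node h x = lift_node h y"
    then show "x = y" using that by (cases x; cases y) (auto simp: inj_image_eq_iff)
  qed
  have "inj (incl :: ('a + real) V3 \<Rightarrow> _)"
    unfolding incl_def by (intro inj injI) simp
  then show ?thesis
    using assms(3,4) by (cases u; cases v) (auto simp: inj_image_eq_iff)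
qed

lemma set_code_eqI:
  assumes "u \<in> universe X" "z \<subseteq> X" "z \<noteq> {}"
    and "\<And>w. w \<in> universe X \<Longrightarrow> w \<in> members u \<longleftrightarrow> w \<in> members (set_code z)"
  shows "u = set_code z"
proof (rule universe_eqI[OF assms(1)])
  show "set_code z \<in> universe X" using assms(2) by simp
  then show "members u = members (set_code z)"
    using members_universe[OF assms(1)] members_universe[of "set_code z" X] assms(4) by blast
  show "members (set_code z) \<noteq> {}" using assms(3) by simp
qed

lemma coll_code_eqI:
  assumes "u \<in> universe X" "W \<subseteq> Pow X" "W \<noteq> {}" "members u = set_code ` W"
  shows "u = coll_code W"
  using assms by (intro universe_eqI[OF assms(1)]) auto

section \<open>A first-order description of the filter\<close>

text \<open>
For the code \<open>C\<close> of a relation between sets and reals, this says that the pair of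
\<open>u\<close> and \<open>v\<close> is in \<open>C\<close>. The first component is the member of
the only singleton in the pair, and the second is the only other object that occurs in the members
of the pair, as a set of points is never a real.
\<close>

definition in_rel ::
    "('a + real) V4 set \<Rightarrow> ('a + real) V4 \<Rightarrow> ('a + real) V4 \<Rightarrow> ('a + real) V4 \<Rightarrow> bool" where
  "in_rel U C u v \<longleftrightarrow>
     (\<exists>q\<in>U. q \<in> members C \<and>
        (\<exists>t\<in>U. t \<in> members q \<and> (\<forall>w\<in>U. w \<in> members t \<longleftrightarrow> w = u)) \<and>
        (\<exists>t\<in>U. t \<in> members q \<and> v \<in> members t) \<and> \<not> v = u)"

text \<open>
In the following definitions \<open>p\<close> is the code of \<open>\<mu>\<close>; points are the
members of the sets in its domain.
\<close>

definition is_point :: "('a + real) V4 set \<Rightarrow> ('a + real) V4 \<Rightarrow> ('a + real) V4 \<Rightarrow> bool" where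
  "is_point U p x \<longleftrightarrow> (\<exists>T\<in>U. \<exists>v\<in>U. in_rel U p T v \<and> x \<in> members T)"

text \<open>
These are the clauses of an inductive definition of the relation between a finite set and the sum
of its weights, \<open>d\<close> on \<open>S\<close> and \<open>a\<close> off \<open>S\<close>: it
starts with \<open>(\<emptyset>, 0)\<close> and adds one point at a time. The empty set is
recognised among the memberless objects by lying in the domain of \<open>\<mu>\<close>, and the
number 0 by \<open>k + k = k\<close>.
\<close>

definition sum_closed ::
    "('a + real) V4 set \<Rightarrow> ('a + real) V4 \<Rightarrow> ('a + real) V4 \<Rightarrow> ('a + real) V4 \<Rightarrow> ('a + real) V4 \<Rightarrow>
     ('a + real) V4 \<Rightarrow> bool" where
  "sum_closed U p S d a C \<longleftrightarrow>
     (\<forall>z\<in>U. \<forall>v\<in>U. \<forall>k\<in>U.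
        in_rel U p z v \<and> (\<forall>x\<in>U. \<not> x \<in> members z) \<and> is_sum k k k \<longrightarrow> in_rel U C z k) \<and>
     (\<forall>z\<in>U. \<forall>s\<in>U. \<forall>x\<in>U. \<forall>z'\<in>U. \<forall>s'\<in>U.
        in_rel U C z s \<and> is_point U p x \<and> \<not> x \<in> members z \<and>
        (\<forall>w\<in>U. w \<in> members z' \<longleftrightarrow> w \<in> members z \<or> w = x) \<and>
        (x \<in> members S \<and> is_sum s d s' \<or> \<not> x \<in> members S \<and> is_sum s a s') \<longrightarrow>
        in_rel U C z' s')"

text \<open>
Belonging to the least closed relation means that \<open>z\<close> is finite and \<open>s\<close>
is the sum of the weights over \<open>z\<close>; the least relation expresses by one quantifier
over relations what is otherwise a recursion.
\<close>

definition sum_on ::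
    "('a + real) V4 set \<Rightarrow> ('a + real) V4 \<Rightarrow> ('a + real) V4 \<Rightarrow> ('a + real) V4 \<Rightarrow> ('a + real) V4 \<Rightarrow>
     ('a + real) V4 \<Rightarrow> ('a + real) V4 \<Rightarrow> bool" where
  "sum_on U p S d a z s \<longleftrightarrow> (\<forall>C\<in>U. sum_closed U p S d a C \<longrightarrow> in_rel U C z s)"

text \<open>
With all weights 0 the sum is 0 on finite sets and undefined elsewhere, whatever stands in the
place of \<open>S\<close>.
\<close>

definition is_fin :: "('a + real) V4 set \<Rightarrow> ('a + real) V4 \<Rightarrow> ('a + real) V4 \<Rightarrow> bool" where
  "is_fin U p z \<longleftrightarrow> (\<exists>k\<in>U. is_sum k k k \<and> sum_on U p z k k z k)"

definition is_pos :: "('a + real) V4 set \<Rightarrow> ('a + real) V4 \<Rightarrow> bool" where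
  "is_pos U s \<longleftrightarrow> (\<exists>k\<in>U. is_sum k k k \<and> is_less k s)"

text \<open>
The inequality \<open>0 < (d - a) * \<mu> S + a\<close>, evaluated step by step.
\<close>

definition pos_mean ::
    "('a + real) V4 set \<Rightarrow> ('a + real) V4 \<Rightarrow> ('a + real) V4 \<Rightarrow> ('a + real) V4 \<Rightarrow> ('a + real) V4 \<Rightarrow>
     bool" where
  "pos_mean U p S d a \<longleftrightarrow>
     (\<exists>r\<in>U. \<exists>t\<in>U. \<exists>w\<in>U. \<exists>v\<in>U.
        in_rel U p S r \<and> is_sum t a d \<and> is_prod t r w \<and> is_sum w a v \<and> is_pos U v)"

definition is_generator :: "('a + real) V4 set \<Rightarrow> ('a + real) V4 \<Rightarrow> ('a + real) V4 \<Rightarrow> bool" where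
  "is_generator U p W \<longleftrightarrow>
     (\<exists>x\<in>U. is_point U p x \<and>
        (\<forall>z\<in>U. z \<in> members W \<longleftrightarrow> is_fin U p z \<and> x \<in> members z)) \<or>
     (\<exists>S\<in>U. \<exists>d\<in>U. \<exists>a\<in>U. pos_mean U p S d a \<and>
        (\<forall>z\<in>U. z \<in> members W \<longleftrightarrow> (\<exists>s\<in>U. sum_on U p S d a z s \<and> is_pos U s)))"

text \<open>
The second clause combines closure under intersections and under supersets.
\<close>

definition closed_family :: "('a + real) V4 set \<Rightarrow> ('a + real) V4 \<Rightarrow> ('a + real) V4 \<Rightarrow> bool" where
  "closed_family U p y \<longleftrightarrow>
     (\<forall>W\<in>U. is_generator U p W \<longrightarrow> W \<in> members y) \<and>
     (\<forall>V\<in>U. \<forall>W\<in>U. \<forall>Z\<in>U. V \<in> members y \<and> W \<in> members y \<and>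
        (\<forall>z\<in>U. z \<in> members V \<and> z \<in> members W \<longrightarrow> z \<in> members Z) \<and>
        (\<forall>z\<in>U. z \<in> members Z \<longrightarrow> is_fin U p z) \<longrightarrow> Z \<in> members y)"

definition least_closed_family ::
    "('a + real) V4 set \<Rightarrow> ('a + real) V4 \<Rightarrow> ('a + real) V4 \<Rightarrow> bool" where
  "least_closed_family U p y \<longleftrightarrow> closed_family U p y \<and>
     (\<forall>y'\<in>U. closed_family U p y' \<longrightarrow> (\<forall>W\<in>U. W \<in> members y \<longrightarrow> W \<in> members y'))"

lemma expressible_in_rel [express]: "expressible U (\<lambda>e. in_rel U (e i) (e j) (e k))"
  unfolding in_rel_def by (intro express)

lemma expressible_is_point [express]: "expressible U (\<lambda>e. is_point U (e i) (e j))"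
  unfolding is_point_def by (intro express)

lemma expressible_sum_closed [express]:
  "expressible U (\<lambda>e. sum_closed U (e i) (e j) (e k) (e l) (e m))"
  unfolding sum_closed_def by (intro express)

lemma expressible_sum_on [express]:
  "expressible U (\<lambda>e. sum_on U (e i) (e j) (e k) (e l) (e m) (e n))"
  unfolding sum_on_def by (intro express)

lemma expressible_is_fin [express]: "expressible U (\<lambda>e. is_fin U (e i) (e j))"
  unfolding is_fin_def by (intro express)

lemma expressible_is_pos [express]: "expressible U (\<lambda>e. is_pos U (e i))"
  unfolding is_pos_def by (intro express)

lemma expressible_pos_mean [express]:
  "expressible U (\<lambda>e. pos_mean U (e i) (e j) (e k) (e l))"
  unfolding pos_mean_def by (intro express)

lemma expressible_is_generator [express]: "expressible U (\<lambda>e. is_generator U (e i) (e j))"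
  unfolding is_generator_def by (intro express)

lemma expressible_closed_family [express]: "expressible U (\<lambda>e. closed_family U (e i) (e j))"
  unfolding closed_family_def by (intro express)

lemma expressible_least_closed_family:
  "expressible U (\<lambda>e. least_closed_family U (e i) (e j))"
  unfolding least_closed_family_def by (intro express)

text \<open>
The Kuratowski pair of \<open>z\<close> and \<open>r\<close> has the two members
\<open>{z}\<close> and \<open>{z, r}\<close>, and only the first one is a singleton.
\<close>

lemma in_rel_rel_code:
  assumes "fst ` R \<subseteq> Pow X"
  shows "in_rel (universe X) (rel_code R) u v \<longleftrightarrow>
    (\<exists>z r. (z, r) \<in> R \<and> u = set_code z \<and> v = Atom (Inr r))"
proof -
  define sing :: "'a set \<Rightarrow> ('a + real) V4" where
    "sing z = Coll {Coll ((\<lambda>x. Atom (Inl x)) ` z)}" for z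
  define dbl :: "'a set \<Rightarrow> real \<Rightarrow> ('a + real) V4" where
    "dbl z r = Coll {Coll ((\<lambda>x. Atom (Inl x)) ` z), Atom (Inr r)}" for z r
  define pair :: "'a set \<times> real \<Rightarrow> ('a + real) V4" where
    "pair = (\<lambda>(z, r). incl (kpair (Coll (Inl ` z)) (Atom (Inr r))))"
  have C: "members (rel_code R) = pair ` R"
    by (simp add: rel_code_def pair_def image_image case_prod_beta)
  have P: "members (pair (z, r)) = {sing z, dbl z r}" for z r
    by (simp add: pair_def kpair_def incl_def sing_def dbl_def image_image)
  have S: "members (sing z) = {set_code z}" for z
    by (simp add: sing_def set_code_def incl_def image_image)
  have D: "members (dbl z r) = {set_code z, Atom (Inr r)}" for z r
    by (simp add: dbl_def set_code_def incl_def image_image)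
  have ne: "set_code z \<noteq> Atom (Inr r)" for z :: "'a set" and r
    by (simp add: set_code_def)
  show ?thesis
  proof
    assume "in_rel (universe X) (rel_code R) u v"
    then obtain q t t' where q: "q \<in> members (rel_code R)" "t \<in> members q" "t' \<in> members q"
      and t: "\<forall>w\<in>universe X. w \<in> members t \<longleftrightarrow> w = u" "v \<in> members t'" "v \<noteq> u"
      unfolding in_rel_def by blast
    then obtain z r where zr: "(z, r) \<in> R" "t \<in> {sing z, dbl z r}" "t' \<in> {sing z, dbl z r}"
      using P unfolding C by (elim imageE, hypsubst_thin) force
    have z: "set_code z \<in> universe X" using zr(1) assms by force
    have "set_code z \<in> members t" using zr(2) S D by auto
    then have u: "set_code z = u" using t(1) z by blast
    have "v \<in> {set_code z, Atom (Inr r)}" using zr(3) t(2) S D by auto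
    then have "v = Atom (Inr r)" using t(3) u by simp
    then show "\<exists>z r. (z, r) \<in> R \<and> u = set_code z \<and> v = Atom (Inr r)"
      using zr(1) u by blast
  next
    assume "\<exists>z r. (z, r) \<in> R \<and> u = set_code z \<and> v = Atom (Inr r)"
    then obtain z r where zr: "(z, r) \<in> R" "u = set_code z" "v = Atom (Inr r)" by blast
    have q: "pair (z, r) \<in> members (rel_code R)" using zr(1) by (simp add: C)
    then have "pair (z, r) \<in> universe X"
      using members_universe[OF rel_code_in_universe[OF assms]] by blast
    moreover from this have U: "sing z \<in> universe X" "dbl z r \<in> universe X"
      using members_universe P by blast+
    moreover have "\<exists>t\<in>universe X. t \<in> members (pair (z, r)) \<and>
        (\<forall>w\<in>universe X. w \<in> members t \<longleftrightarrow> w = u)"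
      by (rule bexI[OF _ U(1)]) (simp add: P S zr)
    moreover have "\<exists>t\<in>universe X. t \<in> members (pair (z, r)) \<and> v \<in> members t"
      by (rule bexI[OF _ U(2)]) (simp add: P D zr)
    moreover have "v \<noteq> u" using ne[of z r] zr by simp
    ultimately show "in_rel (universe X) (rel_code R) u v"
      unfolding in_rel_def using q by blast
  qed
qed

lemma is_sum_self_iff: "is_sum k k k \<longleftrightarrow> k = Atom (Inr 0)"
  by (auto simp: is_sum_def)

lemma is_pos_iff: "is_pos (universe X) s \<longleftrightarrow> (\<exists>r>0. s = Atom (Inr r))"
  by (auto simp: is_pos_def is_sum_self_iff is_less_def)

context fa_space
begin

abbreviation (input) "U \<equiv> universe X"

abbreviation (input) "p \<equiv> code_measure \<A> \<mu>"

lemma code_measure_in_universe: "p \<in> U"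
  unfolding code_measure_eq
  by (intro rel_code_in_universe) (simp add: image_image space_closed)

lemma in_rel_measure: "in_rel U p u v \<longleftrightarrow> (\<exists>S\<in>\<A>. u = set_code S \<and> v = Atom (Inr (\<mu> S)))"
proof -
  have "fst ` (\<lambda>S. (S, \<mu> S)) ` \<A> \<subseteq> Pow X"
    by (simp add: image_image space_closed)
  then show ?thesis unfolding code_measure_eq by (subst in_rel_rel_code) auto
qed

lemma is_point_iff: "is_point U p x \<longleftrightarrow> (\<exists>y\<in>X. x = Atom (Inl y))"
proof
  assume "is_point U p x"
  then show "\<exists>y\<in>X. x = Atom (Inl y)"
    unfolding is_point_def in_rel_measure using sets_into_space by fastforce
next
  assume "\<exists>y\<in>X. x = Atom (Inl y)"
  then show "is_point U p x"
    unfolding is_point_def in_rel_measure using top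
    by (intro bexI[of _ "set_code X"] bexI[of _ "Atom (Inr (\<mu> X))"]) auto
qed

text \<open>
The graph of the weighted sum is itself closed in the sense of \<open>sum_closed\<close> and lies
in the universe. By induction on the finite set, it is contained in every closed relation,
including those that are not codes of relations between sets and reals.
\<close>

lemma sum_on_iff:
  "sum_on U p S (Atom (Inr d)) (Atom (Inr a)) z s \<longleftrightarrow>
     (\<exists>z\<^sub>0\<in>Fpow X. z = set_code z\<^sub>0 \<and>
        s = Atom (Inr (\<Sum>x\<in>z\<^sub>0. if Atom (Inl x) \<in> members S then d else a)))"
  (is "?l \<longleftrightarrow> (\<exists>z\<^sub>0\<in>Fpow X. z = set_code z\<^sub>0 \<and> s = Atom (Inr (?w z\<^sub>0)))")
proof
  define R where "R = (\<lambda>z\<^sub>0. (z\<^sub>0, ?w z\<^sub>0)) ` Fpow X"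
  have sub: "fst ` R \<subseteq> Pow X" by (auto simp: R_def Fpow_def)
  have in_C: "in_rel U (rel_code R) u v \<longleftrightarrow>
      (\<exists>z\<^sub>0\<in>Fpow X. u = set_code z\<^sub>0 \<and> v = Atom (Inr (?w z\<^sub>0)))" for u v
    unfolding in_rel_rel_code[OF sub] by (auto simp: R_def)
  have "sum_closed U p S (Atom (Inr d)) (Atom (Inr a)) (rel_code R)"
    unfolding sum_closed_def
  proof (intro conjI ballI impI; elim conjE)
    fix z v k :: "('a + real) V4"
    assume "in_rel U p z v" "\<forall>x\<in>U. x \<notin> members z" "is_sum k k k"
    then obtain T where T: "T \<in> \<A>" "z = set_code T" "k = Atom (Inr 0)"
      by (auto simp: in_rel_measure is_sum_self_iff)
    have "T = {}"
    proof (rule ccontr)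
      assume "T \<noteq> {}"
      then obtain y where "y \<in> T" by blast
      moreover from this have "Atom (Inl y) \<in> U" using sets_into_space[OF T(1)] by auto
      ultimately show False using T(2) \<open>\<forall>x\<in>U. x \<notin> members z\<close> by auto
    qed
    then show "in_rel U (rel_code R) z k"
      unfolding in_C using T by (intro bexI[of _ "{}"]) (auto simp: Fpow_def)
  next
    fix z s x z' s' :: "('a + real) V4"
    assume z': "z' \<in> U" and zs: "in_rel U (rel_code R) z s" and x: "is_point U p x" "x \<notin> members z"
      and mem: "\<forall>w\<in>U. w \<in> members z' \<longleftrightarrow> w \<in> members z \<or> w = x"
      and s': "x \<in> members S \<and> is_sum s (Atom (Inr d)) s' \<or>
        x \<notin> members S \<and> is_sum s (Atom (Inr a)) s'"
    obtain z\<^sub>0 where z0: "z\<^sub>0 \<in> Fpow X" "z = set_code z\<^sub>0" "s = Atom (Inr (?w z\<^sub>0))"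
      using zs in_C by blast
    obtain y where y: "y \<in> X" "x = Atom (Inl y)" using x(1) is_point_iff by blast
    have new: "y \<notin> z\<^sub>0" using x(2) y z0 by auto
    have "z' = set_code (insert y z\<^sub>0)"
      using z0 y mem by (intro set_code_eqI[OF z']) (auto simp: Fpow_def)
    moreover have "s' = Atom (Inr (?w (insert y z\<^sub>0)))"
      using s' z0 y new by (auto simp: is_sum_def Fpow_def add.commute)
    ultimately show "in_rel U (rel_code R) z' s'"
      unfolding in_C using z0 y by (intro bexI[of _ "insert y z\<^sub>0"]) (auto simp: Fpow_def)
  qed
  moreover have "rel_code R \<in> U" using sub by simp
  moreover assume ?l
  ultimately show "\<exists>z\<^sub>0\<in>Fpow X. z = set_code z\<^sub>0 \<and> s = Atom (Inr (?w z\<^sub>0))"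
    unfolding in_C[symmetric] sum_on_def by blast
next
  assume "\<exists>z\<^sub>0\<in>Fpow X. z = set_code z\<^sub>0 \<and> s = Atom (Inr (?w z\<^sub>0))"
  then obtain z\<^sub>0 where z0: "finite z\<^sub>0" "z\<^sub>0 \<subseteq> X" "z = set_code z\<^sub>0" "s = Atom (Inr (?w z\<^sub>0))"
    by (auto simp: Fpow_def)
  show ?l
    unfolding sum_on_def
  proof (intro ballI impI)
    fix C assume C: "sum_closed U p S (Atom (Inr d)) (Atom (Inr a)) C"
    have "in_rel U C (set_code z\<^sub>0) (Atom (Inr (?w z\<^sub>0)))"
      using z0(1,2)
    proof (induction z\<^sub>0)
      case empty
      have "in_rel U p (set_code {}) (Atom (Inr (\<mu> {})))"
        using empty_sets in_rel_measure by blast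
      then show ?case
        using C[unfolded sum_closed_def, THEN conjunct1, rule_format,
            of "set_code {}" "Atom (Inr (\<mu> {}))" "Atom (Inr 0)"]
        by (simp add: is_sum_self_iff)
    next
      case (insert y z\<^sub>0)
      show ?case
      proof (rule C[unfolded sum_closed_def, THEN conjunct2, rule_format,
            of "set_code z\<^sub>0" "Atom (Inr (?w z\<^sub>0))" "Atom (Inl y)"])
        show "in_rel U C (set_code z\<^sub>0) (Atom (Inr (?w z\<^sub>0))) \<and> is_point U p (Atom (Inl y)) \<and>
          Atom (Inl y) \<notin> members (set_code z\<^sub>0) \<and>
          (\<forall>w\<in>U. (w \<in> members (set_code (insert y z\<^sub>0))) =
                  (w \<in> members (set_code z\<^sub>0) \<or> w = Atom (Inl y))) \<and>
          (Atom (Inl y) \<in> members S \<and>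
             is_sum (Atom (Inr (?w z\<^sub>0))) (Atom (Inr d)) (Atom (Inr (?w (insert y z\<^sub>0)))) \<or>
           Atom (Inl y) \<notin> members S \<and>
             is_sum (Atom (Inr (?w z\<^sub>0))) (Atom (Inr a)) (Atom (Inr (?w (insert y z\<^sub>0)))))"
          using insert by (auto simp: is_sum_def is_point_iff)
      qed (use insert in auto)
    qed
    then show "in_rel U C z s" using z0 by simp
  qed
qed

lemma is_fin_iff: "is_fin U p z \<longleftrightarrow> (\<exists>z\<^sub>0\<in>Fpow X. z = set_code z\<^sub>0)"
  by (auto simp: is_fin_def is_sum_self_iff sum_on_iff)

lemma pos_mean_iff:
  "pos_mean U p S d a \<longleftrightarrow> (\<exists>T\<in>\<A>. \<exists>d' a'. S = set_code T \<and> d = Atom (Inr d') \<and>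
     a = Atom (Inr a') \<and> 0 < (d' - a') * \<mu> T + a')"
proof
  assume "pos_mean U p S d a"
  then show "\<exists>T\<in>\<A>. \<exists>d' a'. S = set_code T \<and> d = Atom (Inr d') \<and>
     a = Atom (Inr a') \<and> 0 < (d' - a') * \<mu> T + a'"
    by (auto simp: pos_mean_def in_rel_measure is_sum_def is_prod_def is_pos_iff)
next
  assume "\<exists>T\<in>\<A>. \<exists>d' a'. S = set_code T \<and> d = Atom (Inr d') \<and>
     a = Atom (Inr a') \<and> 0 < (d' - a') * \<mu> T + a'"
  then obtain T d' a' where T: "T \<in> \<A>" "S = set_code T" "d = Atom (Inr d')"
     "a = Atom (Inr a')" "0 < (d' - a') * \<mu> T + a'" by blast
  show "pos_mean U p S d a"
    unfolding pos_mean_def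
    by (intro bexI[of _ "Atom (Inr (\<mu> T))"] bexI[of _ "Atom (Inr (d' - a'))"]
        bexI[of _ "Atom (Inr ((d' - a') * \<mu> T))"] bexI[of _ "Atom (Inr ((d' - a') * \<mu> T + a'))"])
      (use T in \<open>auto simp: in_rel_measure is_sum_def is_prod_def is_pos_iff\<close>)
qed

lemma is_generator_iff:
  assumes "W \<in> U"
  shows "is_generator U p W \<longleftrightarrow> (\<exists>G\<in>generators X \<A> \<mu>. members W = set_code ` G)"
proof -
  have eq: "(\<forall>z\<in>U. z \<in> members W \<longleftrightarrow> (\<exists>z\<^sub>0\<in>Fpow X. z = set_code z\<^sub>0 \<and> P z\<^sub>0)) \<longleftrightarrow>
      members W = set_code ` {z \<in> Fpow X. P z}" for P
  proof -
    have "set_code ` {z \<in> Fpow X. P z} \<subseteq> U" by (auto simp: Fpow_def)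
    then show ?thesis using members_universe[OF assms] by blast
  qed
  have point_gen: "(\<forall>z\<in>U. z \<in> members W \<longleftrightarrow> is_fin U p z \<and> Atom (Inl x) \<in> members z) \<longleftrightarrow>
      members W = set_code ` {z \<in> Fpow X. x \<in> z}" for x
    unfolding eq[symmetric] is_fin_iff by (intro ball_cong refl arg_cong2[where f = "(=)"]) auto
  have sum_gen: "(\<forall>z\<in>U. z \<in> members W \<longleftrightarrow>
        (\<exists>s\<in>U. sum_on U p (set_code T) (Atom (Inr d)) (Atom (Inr a)) z s \<and> is_pos U s)) \<longleftrightarrow>
      members W = set_code ` {z \<in> Fpow X. 0 < (\<Sum>x\<in>z. if x \<in> T then d else a)}" for T d a
    unfolding eq[symmetric] sum_on_iff is_pos_iff
    by (intro ball_cong refl arg_cong2[where f = "(=)"]) (auto simp: image_iff)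
  show ?thesis
  proof
    assume "is_generator U p W"
    then show "\<exists>G\<in>generators X \<A> \<mu>. members W = set_code ` G"
      unfolding is_generator_def
    proof (elim disjE bexE conjE)
      fix x assume "is_point U p x" "\<forall>z\<in>U. (z \<in> members W) = (is_fin U p z \<and> x \<in> members z)"
      then show ?thesis unfolding is_point_iff generators_def using point_gen by blast
    next
      fix S d a assume "pos_mean U p S d a" 
        and W: "\<forall>z\<in>U. (z \<in> members W) = (\<exists>s\<in>U. sum_on U p S d a z s \<and> is_pos U s)"
      then obtain T d' a' where T: "T \<in> \<A>" "S = set_code T" "d = Atom (Inr d')"
        "a = Atom (Inr a')" "0 < (d' - a') * \<mu> T + a'" unfolding pos_mean_iff by blast
      have "members W = set_code ` {z \<in> Fpow X. 0 < (\<Sum>x\<in>z. if x \<in> T then d' else a')}"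
        using W unfolding T sum_gen .
      then show ?thesis unfolding generators_def using T(1,5) by blast
    qed
  next
    assume "\<exists>G\<in>generators X \<A> \<mu>. members W = set_code ` G"
    then obtain G where G: "G \<in> generators X \<A> \<mu>" "members W = set_code ` G" by blast
    from G(1) consider x where "x \<in> X" "G = {z \<in> Fpow X. x \<in> z}"
      | S d a where "S \<in> \<A>" "0 < (d - a) * \<mu> S + a"
        "G = {z \<in> Fpow X. 0 < (\<Sum>x\<in>z. if x \<in> S then d else a)}"
      unfolding generators_def by blast
    then show "is_generator U p W"
    proof cases
      case 1
      have "is_point U p (Atom (Inl x))" using 1(1) is_point_iff by blast
      moreover have "\<forall>z\<in>U. z \<in> members W \<longleftrightarrow> is_fin U p z \<and> Atom (Inl x) \<in> members z"
        unfolding point_gen using G(2) 1(2) by simp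
      moreover have "Atom (Inl x) \<in> U" using 1(1) by simp
      ultimately show ?thesis unfolding is_generator_def by (intro disjI1) (rule bexI, rule conjI)
    next
      case (2 S d a)
      have "pos_mean U p (set_code S) (Atom (Inr d)) (Atom (Inr a))"
        using 2 pos_mean_iff by blast
      moreover have "\<forall>z\<in>U. z \<in> members W \<longleftrightarrow>
          (\<exists>s\<in>U. sum_on U p (set_code S) (Atom (Inr d)) (Atom (Inr a)) z s \<and> is_pos U s)"
        unfolding sum_gen using G(2) 2(3) by simp
      moreover have "set_code S \<in> U" using sets_into_space[OF 2(1)] by simp
      ultimately show ?thesis unfolding is_generator_def
        by (intro disjI2 bexI[of _ "set_code S"] bexI[of _ "Atom (Inr d)"]
            bexI[of _ "Atom (Inr a)"] conjI real_in_universe)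
    qed
  qed
qed

lemma closed_familyD:
  assumes y: "closed_family U p y"
  shows "G \<in> generators X \<A> \<mu> \<Longrightarrow> coll_code G \<in> members y"
    and "coll_code V \<in> members y \<Longrightarrow> coll_code W \<in> members y \<Longrightarrow> V \<subseteq> Fpow X \<Longrightarrow> W \<subseteq> Fpow X \<Longrightarrow>
      V \<inter> W \<subseteq> Z \<Longrightarrow> Z \<subseteq> Fpow X \<Longrightarrow> coll_code Z \<in> members y"
proof -
  have in_U: "coll_code Z \<in> U" if "Z \<subseteq> Fpow X" for Z
    using that by (intro coll_code_in_universe) (auto simp: Fpow_def)
  show "coll_code G \<in> members y" if G: "G \<in> generators X \<A> \<mu>"
  proof -
    have "coll_code G \<in> U" using G by (intro in_U) (auto simp: generators_def)
    moreover from this have "is_generator U p (coll_code G)" using G by (auto simp: is_generator_iff)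
    ultimately show ?thesis using y by (simp add: closed_family_def)
  qed
  assume *: "coll_code V \<in> members y" "coll_code W \<in> members y" "V \<subseteq> Fpow X" "W \<subseteq> Fpow X"
    "V \<inter> W \<subseteq> Z" "Z \<subseteq> Fpow X"
  have "\<forall>z\<in>U. z \<in> members (coll_code V) \<and> z \<in> members (coll_code W) \<longrightarrow> z \<in> members (coll_code Z)"
    using *(5) by auto
  moreover have "\<forall>z\<in>U. z \<in> members (coll_code Z) \<longrightarrow> is_fin U p z"
    using *(6) by (auto simp: is_fin_iff)
  ultimately show "coll_code Z \<in> members y"
    using y *(1,2) in_U *(3,4,6) unfolding closed_family_def by blast
qed

text \<open>
The empty set is excluded from \<open>\<F>\<close> because the quantifiers also range over the
atoms, which have the same members as its code but do not belong to the code of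
\<open>\<F>\<close>.
\<close>

lemma closed_family_code_family:
  assumes sub: "\<And>W. W \<in> \<F> \<Longrightarrow> W \<subseteq> Fpow X" and ne: "{} \<notin> \<F>"
    and gen: "generators X \<A> \<mu> \<subseteq> \<F>"
    and int: "\<And>V W Z. V \<in> \<F> \<Longrightarrow> W \<in> \<F> \<Longrightarrow> V \<inter> W \<subseteq> Z \<Longrightarrow> Z \<subseteq> Fpow X \<Longrightarrow> Z \<in> \<F>"
  shows "closed_family U p (code_family \<F>)"
  unfolding closed_family_def
proof (intro conjI ballI impI)
  fix W :: "('a + real) V4" assume W: "W \<in> U" "is_generator U p W"
  then obtain G where G: "G \<in> generators X \<A> \<mu>" "members W = set_code ` G"
    using is_generator_iff by blast
  then have "G \<in> \<F>" using gen by blast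
  have "G \<subseteq> Pow X" using sub[OF \<open>G \<in> \<F>\<close>] by (auto simp: Fpow_def)
  moreover have "G \<noteq> {}" using ne \<open>G \<in> \<F>\<close> by blast
  ultimately have "W = coll_code G" using G(2) W(1) by (intro coll_code_eqI)
  then show "W \<in> members (code_family \<F>)" using \<open>G \<in> \<F>\<close> by simp
next
  fix V' W' Z' :: "('a + real) V4"
  assume *: "V' \<in> U" "W' \<in> U" "Z' \<in> U"
    and **: "V' \<in> members (code_family \<F>) \<and> W' \<in> members (code_family \<F>) \<and>
      (\<forall>z\<in>U. z \<in> members V' \<and> z \<in> members W' \<longrightarrow> z \<in> members Z') \<and>
      (\<forall>z\<in>U. z \<in> members Z' \<longrightarrow> is_fin U p z)"
  from ** have sup: "\<forall>z\<in>U. z \<in> members V' \<and> z \<in> members W' \<longrightarrow> z \<in> members Z'"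
    by (elim conjE)
  from ** have fin: "\<forall>z\<in>U. z \<in> members Z' \<longrightarrow> is_fin U p z" by (elim conjE)
  obtain V W where VW: "V \<in> \<F>" "W \<in> \<F>" "V' = coll_code V" "W' = coll_code W"
    using ** unfolding members_code_family by (elim conjE imageE)
  define Z where "Z = {z \<in> Fpow X. set_code z \<in> members Z'}"
  have Z: "members Z' = set_code ` Z"
    using fin members_universe[OF *(3)] unfolding Z_def is_fin_iff by blast
  have "z \<in> Z" if "z \<in> V \<inter> W" for z
  proof -
    have z: "z \<in> Fpow X" using that sub[OF VW(1)] by blast
    then have "set_code z \<in> U" by (simp add: Fpow_def)
    moreover have "set_code z \<in> members V'" "set_code z \<in> members W'" using that VW by auto
    ultimately show ?thesis using sup z by (simp add: Z_def)
  qed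
  then have "V \<inter> W \<subseteq> Z" by blast
  moreover have sub: "Z \<subseteq> Fpow X" by (simp add: Z_def)
  ultimately have "Z \<in> \<F>" by (rule int[OF VW(1,2)])
  moreover from this have "Z \<noteq> {}" using ne by blast
  then have "Z' = coll_code Z"
    using Z *(3) sub by (intro coll_code_eqI) (auto simp: Fpow_def)
  ultimately show "Z' \<in> members (code_family \<F>)" by simp
qed

text \<open>
A closed family \<open>y\<close> induces a filter: \<open>P\<close> holds eventually if the code
of \<open>{z \<in> Fpow X. P z}\<close> belongs to \<open>y\<close>. All generators belong to it,
so it refines \<open>F\<close>.
\<close>

lemma filter_family_subset_closed:
  assumes y: "closed_family U p y" and W: "W \<in> filter_family X (fa_filter X \<A> \<mu>)"
  shows "coll_code W \<in> members y"
proof -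
  define H where "H = Abs_filter (\<lambda>P. coll_code {z \<in> Fpow X. P z} \<in> members y)"
  have gen: "coll_code G \<in> members y" if "G \<in> generators X \<A> \<mu>" for G
    using that by (rule closed_familyD(1)[OF y])
  have gen_sub: "G \<subseteq> Fpow X" if "G \<in> generators X \<A> \<mu>" for G
    using that by (auto simp: generators_def)
  obtain x where "x \<in> X" using space_nonempty by blast
  then obtain G\<^sub>0 where G0: "G\<^sub>0 \<in> generators X \<A> \<mu>" by (auto simp: generators_def)
  have ev: "eventually P H \<longleftrightarrow> coll_code {z \<in> Fpow X. P z} \<in> members y" for P
    unfolding H_def
  proof (rule eventually_Abs_filter, unfold_locales)
    show "coll_code {z \<in> Fpow X. True} \<in> members y"
      using gen_sub[OF G0] by (intro closed_familyD(2)[OF y gen[OF G0] gen[OF G0]]) auto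
  next
    fix P Q assume "coll_code {z \<in> Fpow X. P z} \<in> members y" "coll_code {z \<in> Fpow X. Q z} \<in> members y"
    then show "coll_code {z \<in> Fpow X. P z \<and> Q z} \<in> members y"
      by (rule closed_familyD(2)[OF y]) auto
  next
    fix P Q assume "\<forall>z. P z \<longrightarrow> Q z" and P: "coll_code {z \<in> Fpow X. P z} \<in> members y"
    then show "coll_code {z \<in> Fpow X. Q z} \<in> members y"
      by (intro closed_familyD(2)[OF y P P]) auto
  qed
  have "H \<le> F"
    unfolding fa_filter_def
  proof (rule INF_greatest)
    fix G assume G: "G \<in> generators X \<A> \<mu>"
    then have "{z \<in> Fpow X. z \<in> G} = G" using gen_sub by blast
    then show "H \<le> principal G" unfolding le_principal ev using gen[OF G] by simp
  qed
  moreover have "eventually (\<lambda>z. z \<in> W) (fa_filter X \<A> \<mu>)" "W \<subseteq> Fpow X"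
    using W by (auto simp: filter_family_def)
  moreover from this have "{z \<in> Fpow X. z \<in> W} = W" by blast
  ultimately show ?thesis using ev[of "\<lambda>z. z \<in> W"] by (simp add: le_filter_def)
qed

end

context diffuse_fa_space
begin

text \<open>
Least closed families are unique by extensionality. The filter is one of them: it is closed, being
a proper filter that contains the generators, and least by
\<open>filter_family_subset_closed\<close>.
\<close>

lemma definable_filter_family:
  "definable_from U p (code_family (filter_family X (fa_filter X \<A> \<mu>)))"
    (is "definable_from U p (code_family ?\<F>)")
proof (rule definable_fromI)
  show "p \<in> U" by (rule code_measure_in_universe)
  show in_U: "code_family ?\<F> \<in> U"
    by (rule code_family_in_universe) (auto simp: filter_family_def Fpow_def)
  show "expressible U (\<lambda>e. least_closed_family U (e 1) (e 0))"
    by (rule expressible_least_closed_family)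
  have "closed_family U p (code_family ?\<F>)"
  proof (rule closed_family_code_family)
    show "{} \<notin> ?\<F>" using fa_filter_proper by (simp add: filter_family_def trivial_limit_def)
    show "generators X \<A> \<mu> \<subseteq> ?\<F>"
    proof
      fix G assume G: "G \<in> generators X \<A> \<mu>"
      then have "fa_filter X \<A> \<mu> \<le> principal G" unfolding fa_filter_def by (rule INF_lower)
      moreover have "G \<subseteq> Fpow X" using G by (auto simp: generators_def)
      ultimately show "G \<in> ?\<F>" by (simp add: filter_family_def le_principal)
    qed
    show "Z \<in> ?\<F>" if "V \<in> ?\<F>" "W \<in> ?\<F>" "V \<inter> W \<subseteq> Z" "Z \<subseteq> Fpow X" for V W Z
      using that eventually_conj[of "\<lambda>z. z \<in> V" "fa_filter X \<A> \<mu>" "\<lambda>z. z \<in> W"]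
      by (auto simp: filter_family_def elim!: eventually_mono)
  qed (auto simp: filter_family_def)
  moreover have "members (code_family ?\<F>) \<subseteq> members y" if "closed_family U p y" for y
    using filter_family_subset_closed[OF that] by auto
  ultimately have least: "least_closed_family U p (code_family ?\<F>)"
    unfolding least_closed_family_def by blast
  fix u :: "('a + real) V4" assume u: "u \<in> U"
  show "least_closed_family U p u \<longleftrightarrow> u = code_family ?\<F>"
  proof
    assume "least_closed_family U p u"
    then have "members u = members (code_family ?\<F>)"
      using least u in_U members_universe[OF u] members_universe[OF in_U]
      unfolding least_closed_family_def by blast
    moreover have "Fpow X \<in> ?\<F>"
    proof -
      obtain x where "x \<in> X" using space_nonempty by blast
      then have "{z \<in> Fpow X. x \<in> z} \<in> generators X \<A> \<mu>" by (auto simp: generators_def)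
      then have "fa_filter X \<A> \<mu> \<le> principal {z \<in> Fpow X. x \<in> z}"
        unfolding fa_filter_def by (rule INF_lower)
      then show ?thesis
        by (auto simp: filter_family_def le_principal elim: eventually_mono)
    qed
    ultimately show "u = code_family ?\<F>" using u in_U by (intro universe_eqI) auto
  qed (use least in simp)
qed

end

section \<open>The smallest fine filter that computes the integral\<close>

theorem theorem7:
  fixes X :: "'a set" and \<A> :: "'a set set" and \<mu> :: "'a set \<Rightarrow> real"
  assumes "fa_probability X \<A> \<mu>"
    and "\<forall>x\<in>X. {x} \<in> \<A> \<and> \<mu> {x} = 0"
  shows "\<exists>F\<^sub>\<mu>. definable_from (universe X) (code_measure \<A> \<mu>) (code_family (filter_family X F\<^sub>\<mu>))
           \<and> fine_filter X F\<^sub>\<mu> \<and> integrates X \<A> \<mu> F\<^sub>\<mu>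
           \<and> (\<forall>F. fine_filter X F \<and> integrates X \<A> \<mu> F
                 \<longrightarrow> filter_family X F\<^sub>\<mu> \<subseteq> filter_family X F)"
proof -
  interpret diffuse_fa_space X \<A> \<mu>
    using assms by unfold_locales
  show ?thesis
  proof (intro exI conjI allI impI)
    show "definable_from (universe X) (code_measure \<A> \<mu>)
        (code_family (filter_family X (fa_filter X \<A> \<mu>)))"
      by (rule definable_filter_family)
    show "fine_filter X (fa_filter X \<A> \<mu>)" by (rule fine_fa_filter)
    show "integrates X \<A> \<mu> (fa_filter X \<A> \<mu>)" by (rule integrates_fa_filter)
    fix G assume "fine_filter X G \<and> integrates X \<A> \<mu> G"
    then have "G \<le> fa_filter X \<A> \<mu>" using le_fa_filter by blast
    then show "filter_family X (fa_filter X \<A> \<mu>) \<subseteq> filter_family X G"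
      by (auto simp: filter_family_def le_filter_def)
  qed
qed

end
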